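(* Let $d\ge 2$ and $1\le k<d$ be integers, let $\beta\ge 0$, let $\Gamma\subseteq G(d,k)$ and assume that $\Gamma$ is $\beta$-scaling. Let $E\subseteq\mathbb{R}^d$ be a compact $(d,k,\Gamma)$-set. Then $$\dim_{\mathrm F} E \ge \min\{2\beta,d\}.$$ Moreover, if $\beta>d/2$, then $E$ has positive $d$-dimensional Lebesgue measure.
   Context: $G(d,k)$ is the Grassmannian of all $k$-dimensional linear subspaces of $\mathbb{R}^d$, metrised by $d_{(d,k)}(s,t)=d_H(s\cap S^{d-1},t\cap S^{d-1})$, where $d_H$ is the Hausdorff distance and $S^{d-1}$ is the unit sphere of $\mathbb{R}^d$. To each $s\in G(d,k)$ associate, once and for all, an orthonormal basis $\{x_1^s,\dots,x_k^s\}\subseteq\mathbb{R}^d$ of $s$, depending on $s$ in a Borel measurable way; the specific choice is irrelevant. $(d,k,\Gamma)$-sets: for $\Gamma\subseteq G(d,k)$, a set $E\subseteq\mathbb{R}^d$ is a $(d,k,\Gamma)$-set if for all $s\in\Gamma$ there exists $t_s\in\mathbb{R}^d$ such that $t_s+\sum_{i=1}^k r_i x_i^s\in E$ for all $(r_1,\dots,r_k)\in[0,1]^k$. $\beta$-scaling: for $\xi\in\mathbb{R}^d\setminus\{0\}$ and $\eta>0$ let $S_{\xi,\eta}=\{s\in G(d,k): |\xi\cdot x_i^s|<\eta|\xi| \text{ for all } i=1,\dots,k\}$. A set $\Gamma\subseteq G(d,k)$ is $\beta$-scaling, for $\beta\ge 0$, if it supports a nonzero Borel measure $\gamma$ (that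 is, $\gamma$ is a Borel measure on $G(d,k)$ that vanishes outside some Borel subset of $\Gamma$) for which there is a constant $C>0$ with $\gamma(S_{\xi,\eta})\le C\eta^\beta$ for all $\xi\in\mathbb{R}^d\setminus\{0\}$ and all $\eta>0$. Fourier dimension: for a Borel measure $\mu$ on $\mathbb{R}^d$, $\hat\mu(\xi)=\int_{\mathbb{R}^d} e^{-2\pi i\xi\cdot x}\,d\mu(x)$. For a closed set $E\subseteq\mathbb{R}^d$, $\dim_{\mathrm F}E$ is the supremum of those $s\in[0,d]$ for which there exist a Borel probability measure $\mu$ supported on $E$ and a constant $C>0$ with $|\hat\mu(\xi)|\le C|\xi|^{-s/2}$ for all $\xi\in\mathbb{R}^d\setminus\{0\}$. *)

theory Defs
  imports "HOL-Analysis.Analysis" "HOL-Probability.Probability_Measure"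
begin

(* Convention: 0 if one of the sets is empty; the sets are meant to be bounded. *)
definition hausdorff_dist :: "'a::metric_space set \<Rightarrow> 'a set \<Rightarrow> real" where
  "hausdorff_dist A B =
     (if A = {} \<or> B = {} then 0
      else max (SUP a\<in>A. infdist a B) (SUP b\<in>B. infdist b A))"

definition grassmannian :: "nat \<Rightarrow> (real^'d) set set" where
  "grassmannian k = {s. subspace s \<and> dim s = k}"

definition grass_dist :: "(real^'d) set \<Rightarrow> (real^'d) set \<Rightarrow> real" where
  "grass_dist s t = hausdorff_dist (s \<inter> sphere 0 1) (t \<inter> sphere 0 1)"

lemma hausdorff_dist_commute: "hausdorff_dist A B = hausdorff_dist B A"
  by (auto simp: hausdorff_dist_def max.commute)

lemma hausdorff_dist_ge:
  assumes "bounded A" "bounded B" "A \<noteq> {}" "B \<noteq> {}" "a \<in> A"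
  shows "infdist a B \<le> hausdorff_dist A B"
proof -
  obtain e where e: "\<And>x y. x \<in> A \<union> B \<Longrightarrow> y \<in> A \<union> B \<Longrightarrow> dist x y \<le> e"
    using assms(1,2) bounded_two_points[of "A \<union> B"] by (metis bounded_Un)
  obtain b where "b \<in> B" using assms by blast
  then have "bdd_above ((\<lambda>x. infdist x B) ` A)"
    using e by (intro bdd_aboveI2[where M = e] infdist_le2[of b]) auto
  then have "infdist a B \<le> (SUP a\<in>A. infdist a B)"
    using assms(5) by (intro cSUP_upper)
  then show ?thesis using assms by (simp add: hausdorff_dist_def)
qed

lemma hausdorff_dist_nonneg:
  assumes "bounded A" "bounded B"
  shows "0 \<le> hausdorff_dist A B"
proof (cases "A = {} \<or> B = {}")
  case True
  then show ?thesis by (auto simp: hausdorff_dist_def)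
next
  case False
  then obtain a where "a \<in> A" by blast
  then show ?thesis using hausdorff_dist_ge[of A B a] infdist_nonneg[of a B] assms False by simp
qed

lemma hausdorff_dist_le:
  assumes "A \<noteq> {}" "B \<noteq> {}"
    and "\<And>a. a \<in> A \<Longrightarrow> infdist a B \<le> r" "\<And>b. b \<in> B \<Longrightarrow> infdist b A \<le> r"
  shows "hausdorff_dist A B \<le> r"
  unfolding hausdorff_dist_def using assms by (auto intro!: cSUP_least)

lemma hausdorff_dist_triangle:
  fixes A B C :: "'a::heine_borel set"
  assumes "compact A" "compact B" "compact C" "A \<noteq> {}" "B \<noteq> {}" "C \<noteq> {}"
  shows "hausdorff_dist A C \<le> hausdorff_dist A B + hausdorff_dist B C"
proof -
  have *: "infdist x Z \<le> hausdorff_dist X Y + hausdorff_dist Y Z"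
    if h: "x \<in> X" "compact X" "compact Y" "compact Z" "X \<noteq> {}" "Y \<noteq> {}" "Z \<noteq> {}"
    for x and X Y Z :: "'a set"
  proof -
    obtain y where y: "y \<in> Y" "infdist x Y = dist x y"
      using infdist_attains_inf[OF compact_imp_closed] h(3,6) by metis
    have "infdist x Z \<le> infdist y Z + dist x y" by (rule infdist_triangle)
    moreover have "infdist y Z \<le> hausdorff_dist Y Z"
      by (rule hausdorff_dist_ge) (use h y compact_imp_bounded in auto)
    moreover have "dist x y \<le> hausdorff_dist X Y"
      unfolding y(2)[symmetric]
      by (rule hausdorff_dist_ge) (use h compact_imp_bounded in auto)
    ultimately show ?thesis by linarith
  qed
  show ?thesis
  proof (rule hausdorff_dist_le)
    show "infdist a C \<le> hausdorff_dist A B + hausdorff_dist B C" if "a \<in> A" for a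
      by (rule *[OF that assms])
    show "infdist c A \<le> hausdorff_dist A B + hausdorff_dist B C" if "c \<in> C" for c
      using *[OF that assms(3,2,1,6,5,4)] hausdorff_dist_commute[of C B]
        hausdorff_dist_commute[of B A] by linarith
  qed (rule assms(4), rule assms(6))
qed

lemma Metric_space_grassmannian:
  assumes "1 \<le> k"
  shows "Metric_space (grassmannian k :: (real^'d) set set) grass_dist"
proof -
  have comp: "compact (s \<inter> sphere 0 1)" "s \<inter> sphere 0 1 \<noteq> {}"
    if s: "s \<in> grassmannian k" for s :: "(real^'d) set"
  proof -
    have sub: "subspace s" and "dim s \<noteq> 0" using s assms by (auto simp: grassmannian_def)
    show "compact (s \<inter> sphere 0 1)"
      by (intro closed_Int_compact closed_subspace sub compact_sphere)
    obtain v where "v \<in> s" "v \<noteq> 0" using \<open>dim s \<noteq> 0\<close> by (auto simp: dim_eq_0)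
    then have "v /\<^sub>R norm v \<in> s \<inter> sphere 0 1"
      using sub by (simp add: subspace_scale)
    then show "s \<inter> sphere 0 1 \<noteq> {}" by blast
  qed
  have bdd: "bounded (s \<inter> sphere 0 1)" for s :: "(real^'d) set"
    by (rule bounded_subset[OF compact_imp_bounded[OF compact_sphere]]) (rule Int_lower2)
  have incl: "s \<subseteq> t" if st: "s \<in> grassmannian k" "t \<in> grassmannian k"
    and sph: "s \<inter> sphere 0 1 \<subseteq> t" for s t :: "(real^'d) set"
  proof
    fix v assume v: "v \<in> s"
    have sub: "subspace s" "subspace t" using st by (auto simp: grassmannian_def)
    show "v \<in> t"
    proof (cases "v = 0")
      case True then show ?thesis using sub by (simp add: subspace_0)
    next
      case False
      then have "v /\<^sub>R norm v \<in> t" using sub v sph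
        by (intro subsetD[OF sph]) (simp add: subspace_scale)
      then have "norm v *\<^sub>R (v /\<^sub>R norm v) \<in> t"
        by (rule subspace_scale[OF sub(2)])
      then show ?thesis using False by simp
    qed
  qed
  show ?thesis
  proof
    fix s t u :: "(real^'d) set"
    show "grass_dist s t = grass_dist t s"
      by (simp add: grass_dist_def hausdorff_dist_commute)
    show "grass_dist s u \<le> grass_dist s t + grass_dist t u"
      if "s \<in> grassmannian k" "t \<in> grassmannian k" "u \<in> grassmannian k"
      unfolding grass_dist_def using that comp by (intro hausdorff_dist_triangle) auto
    have sub: "X \<inter> sphere 0 1 \<subseteq> Y"
      if XY: "X \<in> grassmannian k" "Y \<in> grassmannian k" and z: "grass_dist X Y = 0"
      for X Y :: "(real^'d) set"
    proof
      fix a assume a: "a \<in> X \<inter> sphere 0 1"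
      have "infdist a (Y \<inter> sphere 0 1) \<le> 0"
        using hausdorff_dist_ge[OF bdd bdd comp(2)[OF XY(1)] comp(2)[OF XY(2)] a] z
        by (simp only: grass_dist_def)
      then have "infdist a (Y \<inter> sphere 0 1) = 0"
        by (intro antisym infdist_nonneg)
      then have "a \<in> Y \<inter> sphere 0 1"
        using in_closed_iff_infdist_zero[OF compact_imp_closed[OF comp(1)] comp(2), OF XY(2) XY(2)]
        by blast
      then show "a \<in> Y" by blast
    qed
    show "grass_dist s t = 0 \<longleftrightarrow> s = t" if "s \<in> grassmannian k" "t \<in> grassmannian k"
    proof
      assume z: "grass_dist s t = 0"
      then have "grass_dist t s = 0"
        by (simp only: grass_dist_def hausdorff_dist_commute)
      with z show "s = t"
        using incl sub that by (meson subset_antisym)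
    next
      assume "s = t"
      moreover have "(SUP a\<in>X. infdist a X) = 0" if "X \<noteq> {}" for X :: "(real^'d) set"
        using that by simp
      ultimately show "grass_dist s t = 0"
        using comp(2)[OF \<open>s \<in> _\<close>] by (simp add: grass_dist_def hausdorff_dist_def)
    qed
  next
    fix s t :: "(real^'d) set"
    show "0 \<le> grass_dist s t"
      unfolding grass_dist_def
      by (intro hausdorff_dist_nonneg bdd)
  qed
qed

definition grass_borel :: "nat \<Rightarrow> (real^'d) set measure" where
  "grass_borel k = sigma (grassmannian k)
     {U. openin (Metric_space.mtopology (grassmannian k) grass_dist) U}"

definition orthonormal_basis_choice :: "nat \<Rightarrow> ((real^'d) set \<Rightarrow> nat \<Rightarrow> real^'d) \<Rightarrow> bool" where
  "orthonormal_basis_choice k x \<longleftrightarrow>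
     (\<forall>s\<in>grassmannian k.
        (\<forall>i\<in>{1..k}. \<forall>j\<in>{1..k}. x s i \<bullet> x s j = (if i = j then 1 else 0)) \<and>
        span (x s ` {1..k}) = s) \<and>
     (\<forall>i\<in>{1..k}. (\<lambda>s. x s i) \<in> borel_measurable (grass_borel k))"

definition dkGamma_set ::
  "nat \<Rightarrow> ((real^'d) set \<Rightarrow> nat \<Rightarrow> real^'d) \<Rightarrow> (real^'d) set set \<Rightarrow> (real^'d) set \<Rightarrow> bool" where
  "dkGamma_set k x \<Gamma> E \<longleftrightarrow>
     (\<forall>s\<in>\<Gamma>. \<exists>t. \<forall>r. (\<forall>i\<in>{1..k}. r i \<in> {0..1}) \<longrightarrow> t + (\<Sum>i=1..k. r i *\<^sub>R x s i) \<in> E)"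

definition slab ::
  "nat \<Rightarrow> ((real^'d) set \<Rightarrow> nat \<Rightarrow> real^'d) \<Rightarrow> real^'d \<Rightarrow> real \<Rightarrow> (real^'d) set set" where
  "slab k x \<xi> \<eta> = {s \<in> grassmannian k. \<forall>i\<in>{1..k}. \<bar>\<xi> \<bullet> x s i\<bar> < \<eta> * norm \<xi>}"

definition beta_scaling ::
  "nat \<Rightarrow> ((real^'d) set \<Rightarrow> nat \<Rightarrow> real^'d) \<Rightarrow> real \<Rightarrow> (real^'d) set set \<Rightarrow> bool" where
  "beta_scaling k x \<beta> \<Gamma> \<longleftrightarrow>
     (\<exists>\<gamma>. sets \<gamma> = sets (grass_borel k) \<and>
          emeasure \<gamma> (space \<gamma>) \<noteq> 0 \<and>
          (\<exists>A\<in>sets \<gamma>. A \<subseteq> \<Gamma> \<and> emeasure \<gamma> (space \<gamma> - A) = 0) \<and>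
          (\<exists>C>0. \<forall>\<xi> \<eta>. \<xi> \<noteq> 0 \<longrightarrow> \<eta> > 0 \<longrightarrow>
             emeasure \<gamma> (slab k x \<xi> \<eta>) \<le> ennreal (C * \<eta> powr \<beta>)))"

definition fourier_transform :: "(real^'d) measure \<Rightarrow> real^'d \<Rightarrow> complex" where
  "fourier_transform \<mu> \<xi> = (\<integral>x. exp (- 2 * of_real pi * \<i> * of_real (\<xi> \<bullet> x)) \<partial>\<mu>)"

(* Intended for closed E. For nonempty E the set contains 0 (take a Dirac measure); for empty E
   it is empty and the value is unspecified. *)
definition fourier_dim :: "(real^'d) set \<Rightarrow> real" where
  "fourier_dim E = Sup {s \<in> {0..real CARD('d)}.
     \<exists>\<mu>. prob_space \<mu> \<and> sets \<mu> = sets borel \<and> emeasure \<mu> (- E) = 0 \<and>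
         (\<exists>C>0. \<forall>\<xi>. \<xi> \<noteq> 0 \<longrightarrow> cmod (fourier_transform \<mu> \<xi>) \<le> C * norm \<xi> powr (- s / 2))}"

end

theory Submission
  imports Defs "HOL-Probability.Characteristic_Functions"
begin

text \<open>
  The theorem rests on one measure on $E$ whose Fourier transform is $O(|\xi|^{-\beta})$. The set $E$
  contains, for every $s \in \Gamma$, a unit cube spanned by the basis of $s$. Put a sufficiently smooth
  probability measure on each of these cubes and average over $s$ with respect to the measure $\gamma$ that
  witnesses the scaling condition. The transform of the measure on the cube of $s$ is small at $\xi$
  unless all the inner products $\xi \cdot x_i^s$ are bounded, that is, unless $s$ lies in the slab
  $S_{\xi,\eta}$ with $\eta$ of order $1 / |\xi|$, and $\gamma$ gives this slab mass
  $O(|\xi|^{-\beta})$. A dyadic decomposition according to the size of the inner products makes this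
  precise (\<open>nn_integral_power_tail\<close>).

  Two points need care. The cubes must be placed measurably in $s$, although only the existence of
  translates is known; this is a measurable selection of zeros of a function that is continuous in the
  translate and has a zero in a compact set (\<open>measurable_zero_selection\<close>). And the
  measure on the cube is realised as the law of averages of independent uniform variables,
  whose transform has arbitrarily fast polynomial decay
  (\<open>averaging_space_phase_decay\<close>). Together these give
  \<open>exists_measure_with_Fourier_decay\<close>, from which the bound on the Fourier dimension is
  immediate.

  If $\beta > d/2$, the transform is square integrable. Then the mass that $\mu \times \mu$ gives to the
  $\delta$-neighbourhood of the diagonal is $O(\delta^d)$ (\<open>near_diagonal_mass\<close>, by
  integrating a Gaussian against $\mu \times \mu$ and passing to the Fourier side), and by
  Cauchy-Schwarz a probability measure with this property cannot be concentrated on a compact null set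
  (\<open>emeasure_lebesgue_pos_if_near_diagonal_mass\<close>).
\<close>

section \<open>Integrating a power against a measure with polynomially small tails\<close>

text \<open>
  Cut the space into the region \<open>a < 2 c\<close> and the dyadic shells $2^j c \le a < 2^{j+1} c$. On the
  $j$-th shell $f$ is at most $2^{-jp}$, while the tail bound gives the shell mass at most
  $K (2^{j+1} c)^b$; as $b < p$, these contributions form a convergent geometric series. The lemma is
  used twice: with the measure on the Grassmannian, where the tail bound is the scaling condition and
  $f$ is the decay of the transform of a single cube, and with Lebesgue measure and $a$ the norm, to
  see that power decay faster than $|\xi|^{-d/2}$ implies square integrability.
\<close>

lemma nn_integral_power_tail:
  fixes a f :: "'a \<Rightarrow> real"
  assumes a[measurable]: "a \<in> borel_measurable M"
    and "b < p" "0 \<le> p" "0 \<le> K" "0 < c"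
    and tail: "\<And>\<eta>. 0 < \<eta> \<Longrightarrow> emeasure M {s \<in> space M. a s < \<eta>} \<le> ennreal (K * \<eta> powr b)"
    and f1: "\<And>s. s \<in> space M \<Longrightarrow> f s \<le> 1"
    and f2: "\<And>s. s \<in> space M \<Longrightarrow> 0 < a s \<Longrightarrow> f s \<le> (c / a s) powr p"
  shows "(\<integral>\<^sup>+s. ennreal (f s) \<partial>M) \<le> ennreal (K * 2 powr b / (1 - 2 powr (b - p)) * c powr b)"
proof -
  \<comment> \<open>Sublevel sets stand in for the shells; this only loses a constant.\<close>
  define A where "A j = {s \<in> space M. a s < c * 2 ^ Suc j}" for j :: nat
  have A[measurable]: "A j \<in> sets M" for j
    unfolding A_def by measurable
  define g where "g j s = ennreal ((2 powr - p) ^ j) * indicator (A j) s" for j s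
  have "ennreal (f s) \<le> (\<Sum>j. g j s)" if s: "s \<in> space M" for s
  proof -
    obtain n :: nat where "a s / c < 2 ^ n"
      using real_arch_pow[of 2 "a s / c"] by auto
    also have "(2::real) ^ n \<le> 2 ^ Suc n" by simp
    finally have ex: "a s / c < 2 ^ Suc n" .
    define J where "J = (LEAST j. a s / c < 2 ^ Suc j)"
    have J: "a s / c < 2 ^ Suc J"
      unfolding J_def by (rule LeastI[of "\<lambda>j. a s / c < 2 ^ Suc j", OF ex])
    have sA: "s \<in> A J"
      using J s \<open>0 < c\<close> by (simp add: A_def field_simps)
    have "f s \<le> (2 powr - p) ^ J"
    proof (cases J)
      case 0
      then show ?thesis using f1[OF s] by simp
    next
      case (Suc j)
      then have "\<not> a s / c < 2 ^ J"
        using not_less_Least[of j "\<lambda>j. a s / c < 2 ^ Suc j"] by (simp add: J_def)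
      then have ge: "c * 2 ^ J \<le> a s"
        using \<open>0 < c\<close> by (simp add: field_simps)
      then have pos: "0 < a s"
        using \<open>0 < c\<close> by (meson less_le_trans mult_pos_pos zero_less_numeral zero_less_power)
      have "f s \<le> (c / a s) powr p" by (rule f2[OF s pos])
      also have "\<dots> \<le> (1 / 2 ^ J) powr p"
        using ge pos \<open>0 < c\<close> \<open>0 \<le> p\<close> by (intro powr_mono2) (auto simp: field_simps)
      also have "\<dots> = (2 powr - p) ^ J"
      proof -
        have "1 / 2 ^ J = (2::real) powr - real J"
          by (simp add: powr_minus_divide powr_realpow)
        moreover have "(2 powr - p) ^ J = (2 powr - p) powr real J"
          by (simp add: powr_realpow)
        ultimately show ?thesis by (simp add: powr_powr mult.commute)
      qed
      finally show ?thesis .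
    qed
    then have "ennreal (f s) \<le> g J s"
      using sA by (simp add: g_def ennreal_leI)
    also have "\<dots> = (\<Sum>j\<in>{J}. g j s)" by simp
    also have "\<dots> \<le> (\<Sum>j. g j s)" by (intro sum_le_suminf) auto
    finally show ?thesis .
  qed
  then have "(\<integral>\<^sup>+s. ennreal (f s) \<partial>M) \<le> (\<integral>\<^sup>+s. (\<Sum>j. g j s) \<partial>M)"
    by (rule nn_integral_mono)
  also have "\<dots> = (\<Sum>j. \<integral>\<^sup>+s. g j s \<partial>M)"
    unfolding g_def by (intro nn_integral_suminf) measurable
  also have "\<dots> \<le> (\<Sum>j. ennreal (K * 2 powr b * c powr b * (2 powr (b - p)) ^ j))"
  proof (intro suminf_le)
    fix j :: nat
    have "(\<integral>\<^sup>+s. g j s \<partial>M) = ennreal ((2 powr - p) ^ j) * emeasure M (A j)"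
      unfolding g_def by (simp add: nn_integral_cmult)
    also have "\<dots> \<le> ennreal ((2 powr - p) ^ j) * ennreal (K * (c * 2 ^ Suc j) powr b)"
      unfolding A_def using \<open>0 < c\<close> by (intro mult_left_mono tail) auto
    also have "\<dots> = ennreal ((2 powr - p) ^ j * (K * (c * 2 ^ Suc j) powr b))"
      using \<open>0 \<le> K\<close> by (simp add: ennreal_mult')
    also have "(c * 2 ^ Suc j) powr b = c powr b * 2 powr b * (2 powr b) ^ j"
      using \<open>0 < c\<close>
      by (simp add: powr_mult powr_realpow[symmetric] powr_powr mult.commute)
    also have "(2 powr - p) ^ j * (K * (c powr b * 2 powr b * (2 powr b) ^ j))
        = K * 2 powr b * c powr b * (2 powr (b - p)) ^ j"
      by (simp add: powr_diff powr_minus power_divide power_inverse field_simps)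
    finally show "(\<integral>\<^sup>+s. g j s \<partial>M) \<le> ennreal (K * 2 powr b * c powr b * (2 powr (b - p)) ^ j)" .
  qed auto
  also have "\<dots> = ennreal (K * 2 powr b * c powr b * (1 / (1 - 2 powr (b - p))))"
  proof (rule suminf_ennreal_eq)
    have "2 powr (b - p) < (1::real)"
      using \<open>b < p\<close> by (simp add: powr_less_one)
    then show "(\<lambda>j. K * 2 powr b * c powr b * (2 powr (b - p)) ^ j) sums
        (K * 2 powr b * c powr b * (1 / (1 - 2 powr (b - p))))"
      by (intro sums_mult geometric_sums) auto
  qed (use \<open>0 \<le> K\<close> in auto)
  finally show ?thesis by (simp add: field_simps)
qed

section \<open>Measurable selection of zeros\<close>

text \<open>
  On a compact set a continuous nonnegative function has a zero as soon as its infimum is 0, and by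
  continuity the infimum may be taken over a countable dense subset. This turns the uncountable
  existential quantifier into countably many measurable conditions.
\<close>

lemma measurable_zero_in_compact:
  fixes F :: "'s \<Rightarrow> 'a::{metric_space,second_countable_topology} \<Rightarrow> real"
  assumes meas: "\<And>t. (\<lambda>s. F s t) \<in> borel_measurable M"
    and cont: "\<And>s. s \<in> space M \<Longrightarrow> continuous_on UNIV (F s)"
    and nonneg: "\<And>s t. s \<in> space M \<Longrightarrow> 0 \<le> F s t"
    and "compact C"
  shows "{s \<in> space M. \<exists>t\<in>C. F s t = 0} \<in> sets M"
proof -
  obtain D where D: "countable D" "D \<subseteq> C" "C \<subseteq> closure D"
    using separable[of C] by blast
  have eq: "(\<exists>t\<in>C. F s t = 0) \<longleftrightarrow> (\<forall>n. \<exists>t\<in>D. F s t < 1 / real (Suc n))" if s: "s \<in> space M" for s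
  proof
    assume "\<exists>t\<in>C. F s t = 0"
    then obtain t where t: "t \<in> C" "F s t = 0" by blast
    show "\<forall>n. \<exists>t\<in>D. F s t < 1 / real (Suc n)"
    proof
      fix n
      have "open {t. F s t < 1 / real (Suc n)}"
        by (intro open_Collect_less cont[OF s] continuous_intros)
      moreover have "t \<in> {t. F s t < 1 / real (Suc n)}" using t by simp
      moreover have "t \<in> closure D" using t D by blast
      ultimately obtain t' where "t' \<in> D" "t' \<in> {t. F s t < 1 / real (Suc n)}"
        by (meson closure_iff_nhds_not_empty disjoint_iff subset_refl)
      then show "\<exists>t\<in>D. F s t < 1 / real (Suc n)" by blast
    qed
  next
    assume R: "\<forall>n. \<exists>t\<in>D. F s t < 1 / real (Suc n)"
    \<comment> \<open>A minimiser over \<open>C\<close> has value below every \<open>1 / (n + 1)\<close>.\<close>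
    have "\<exists>t\<in>C. \<forall>u\<in>C. F s t \<le> F s u"
      using R D by (intro continuous_attains_inf[OF \<open>compact C\<close>]
          continuous_on_subset[OF cont[OF s]]) auto
    then obtain t where t: "t \<in> C" "\<And>u. u \<in> C \<Longrightarrow> F s t \<le> F s u" by blast
    have "F s t < e" if "0 < e" for e
    proof -
      obtain n where "1 / real (Suc n) < e" by (rule nat_approx_posE[OF \<open>0 < e\<close>])
      moreover obtain u where "u \<in> D" "F s u < 1 / real (Suc n)" using R by blast
      ultimately show ?thesis using t(2)[of u] D(2) by force
    qed
    then have "F s t = 0" using nonneg[OF s, of t] by (metis less_irrefl order_le_less)
    then show "\<exists>t\<in>C. F s t = 0" using t by blast
  qed
  have "{s \<in> space M. \<forall>n. \<exists>t\<in>D. F s t < 1 / real (Suc n)} \<in> sets M"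
    using meas D(1) by measurable
  also have "{s \<in> space M. \<forall>n. \<exists>t\<in>D. F s t < 1 / real (Suc n)} = {s \<in> space M. \<exists>t\<in>C. F s t = 0}"
    using eq by blast
  finally show ?thesis .
qed

text \<open>
  Among the zeros in $C$, the smallest possible value $m(s)$ of the $i$-th coordinate is attained, and
  $m(s) \le a$ means exactly that there is a zero in the compact set of all $u \in C$ with $u_i \le a$.
\<close>

lemma measurable_minimal_coordinate:
  fixes F :: "'s \<Rightarrow> real^'d \<Rightarrow> real"
  assumes meas: "\<And>t. (\<lambda>s. F s t) \<in> borel_measurable M"
    and cont: "\<And>s. s \<in> space M \<Longrightarrow> continuous_on UNIV (F s)"
    and nonneg: "\<And>s t. s \<in> space M \<Longrightarrow> 0 \<le> F s t"
    and "compact C"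
    and ex: "\<And>s. s \<in> space M \<Longrightarrow> \<exists>t\<in>C. F s t = 0"
  obtains m where "m \<in> borel_measurable M"
    and "\<And>s. s \<in> space M \<Longrightarrow> \<exists>t\<in>C. F s t = 0 \<and> t $ i = m s"
proof -
  have "\<exists>t\<in>C. F s t = 0 \<and> (\<forall>u\<in>C. F s u = 0 \<longrightarrow> t $ i \<le> u $ i)" if s: "s \<in> space M" for s
  proof -
    have Z: "compact (C \<inter> {t. F s t = 0})"
      by (intro compact_Int_closed \<open>compact C\<close> closed_Collect_eq cont[OF s] continuous_intros)
    have "\<exists>t\<in>C \<inter> {t. F s t = 0}. \<forall>u\<in>C \<inter> {t. F s t = 0}. t $ i \<le> u $ i"
      using ex[OF s] by (intro continuous_attains_inf[OF Z] continuous_intros) auto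
    then show ?thesis by blast
  qed
  then obtain t where t: "\<And>s. s \<in> space M \<Longrightarrow> t s \<in> C" "\<And>s. s \<in> space M \<Longrightarrow> F s (t s) = 0"
      "\<And>s u. s \<in> space M \<Longrightarrow> u \<in> C \<Longrightarrow> F s u = 0 \<Longrightarrow> t s $ i \<le> u $ i"
    by metis
  show thesis
  proof (rule that[of "\<lambda>s. t s $ i"])
    show "(\<lambda>s. t s $ i) \<in> borel_measurable M"
      unfolding borel_measurable_iff_le
    proof
      fix a
      have "{s \<in> space M. t s $ i \<le> a} = {s \<in> space M. \<exists>u\<in>C \<inter> {u. u $ i \<le> a}. F s u = 0}"
        using t(1,2) by (auto intro: t(3)[THEN order_trans])
      also have "\<dots> \<in> sets M"
        by (intro measurable_zero_in_compact meas cont nonneg compact_Int_closed \<open>compact C\<close>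
            closed_Collect_le continuous_intros)
      finally show "{s \<in> space M. t s $ i \<le> a} \<in> sets M" .
    qed
  qed (use t in blast)
qed

text \<open>
  The lexicographically smallest zero would do. Its coordinates can be fixed one after the other: once
  some coordinates have been prescribed measurably, the prescription is absorbed into $F$ by adding
  $\sum_i |t_i - m_i(s)|$, which leaves a function of the same kind whose zeros are the zeros of $F$
  with these coordinates. When all coordinates are fixed the zero is a measurable function of $s$.
\<close>

lemma measurable_zero_selection:
  fixes F :: "'s \<Rightarrow> real^'d \<Rightarrow> real"
  assumes meas: "\<And>t. (\<lambda>s. F s t) \<in> borel_measurable M"
    and cont: "\<And>s. s \<in> space M \<Longrightarrow> continuous_on UNIV (F s)"
    and nonneg: "\<And>s t. s \<in> space M \<Longrightarrow> 0 \<le> F s t"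
    and "compact C"
    and ex: "\<And>s. s \<in> space M \<Longrightarrow> \<exists>t\<in>C. F s t = 0"
  obtains t where "t \<in> borel_measurable M" and "\<And>s. s \<in> space M \<Longrightarrow> F s (t s) = 0"
proof -
  have "\<exists>m. (\<forall>i\<in>I. m i \<in> borel_measurable M) \<and>
      (\<forall>s\<in>space M. \<exists>t\<in>C. F s t = 0 \<and> (\<forall>i\<in>I. t $ i = m i s))" if "finite I" for I :: "'d set"
    using that
  proof (induction I)
    case empty
    then show ?case using ex by auto
  next
    case (insert j I)
    then obtain m where m: "\<And>i. i \<in> I \<Longrightarrow> m i \<in> borel_measurable M"
        "\<And>s. s \<in> space M \<Longrightarrow> \<exists>t\<in>C. F s t = 0 \<and> (\<forall>i\<in>I. t $ i = m i s)"
      by blast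
    define G where "G s t = F s t + (\<Sum>i\<in>I. \<bar>t $ i - m i s\<bar>)" for s t
    have G0: "G s t = 0 \<longleftrightarrow> F s t = 0 \<and> (\<forall>i\<in>I. t $ i = m i s)" if "s \<in> space M" for s t
      unfolding G_def using nonneg[OF that, of t] insert.hyps(1)
      by (subst add_nonneg_eq_0_iff) (auto simp: sum_nonneg sum_nonneg_eq_0_iff)
    obtain m' where m': "m' \<in> borel_measurable M"
        "\<And>s. s \<in> space M \<Longrightarrow> \<exists>t\<in>C. G s t = 0 \<and> t $ j = m' s"
    proof (rule measurable_minimal_coordinate[where F = G and M = M and C = C and i = j])
      show "(\<lambda>s. G s t) \<in> borel_measurable M" for t
        unfolding G_def using m(1) meas by measurable
      show "continuous_on UNIV (G s)" if "s \<in> space M" for s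
        unfolding G_def by (intro continuous_intros cont[OF that])
      show "0 \<le> G s t" if "s \<in> space M" for s t
        unfolding G_def using nonneg[OF that] by (simp add: sum_nonneg)
      show "\<exists>t\<in>C. G s t = 0" if "s \<in> space M" for s
        using m(2)[OF that] G0[OF that] by blast
    qed (use \<open>compact C\<close> in auto)
    have "\<forall>i\<in>insert j I. (m(j := m')) i \<in> borel_measurable M"
      using m(1) m'(1) by auto
    moreover have "\<forall>s\<in>space M. \<exists>t\<in>C. F s t = 0 \<and> (\<forall>i\<in>insert j I. t $ i = (m(j := m')) i s)"
    proof
      fix s assume s: "s \<in> space M"
      then obtain t where "t \<in> C" "G s t = 0" "t $ j = m' s" using m'(2) by blast
      then show "\<exists>t\<in>C. F s t = 0 \<and> (\<forall>i\<in>insert j I. t $ i = (m(j := m')) i s)"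
        using G0[OF s] by (intro bexI[of _ t]) auto
    qed
    ultimately show ?case by blast
  qed
  from this[of UNIV] obtain m :: "'d \<Rightarrow> 's \<Rightarrow> real"
    where m: "\<And>i. m i \<in> borel_measurable M"
      "\<And>s. s \<in> space M \<Longrightarrow> \<exists>t\<in>C. F s t = 0 \<and> (\<forall>i. t $ i = m i s)"
    by auto
  show thesis
  proof (rule that[of "\<lambda>s. \<chi> i. m i s"])
    show "(\<lambda>s. \<chi> i. m i s) \<in> borel_measurable M"
      using m(1) by (subst borel_measurable_euclidean_space) (auto simp: Basis_vec_def inner_axis)
    show "F s (\<chi> i. m i s) = 0" if "s \<in> space M" for s
    proof -
      obtain t where "F s t = 0" "\<forall>i. t $ i = m i s" using m(2)[OF \<open>s \<in> space M\<close>] by blast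
      then show ?thesis by (metis vec_lambda_unique)
    qed
  qed
qed

section \<open>Fourier decay of averages of uniform variables\<close>

definition phase :: "real \<Rightarrow> complex" where
  "phase r = exp (- 2 * of_real pi * \<i> * of_real r)"

lemma phase_eq_cis: "phase r = cis (- 2 * pi * r)"
  by (simp add: phase_def cis_conv_exp mult_ac)

lemma norm_phase [simp]: "cmod (phase r) = 1"
  by (simp add: phase_eq_cis)

lemma phase_0 [simp]: "phase 0 = 1"
  by (simp add: phase_def)

lemma phase_add: "phase (r + s) = phase r * phase s"
  by (simp add: phase_eq_cis cis_mult algebra_simps)

lemma phase_sum: "phase (\<Sum>i\<in>I. f i) = (\<Prod>i\<in>I. phase (f i))"
  by (induction I rule: infinite_finite_induct) (simp_all add: phase_add)

lemma cnj_phase: "cnj (phase r) = phase (- r)"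
  by (simp add: phase_eq_cis cis_cnj)

lemma borel_measurable_phase [measurable]: "phase \<in> borel_measurable borel"
  unfolding phase_def by (intro borel_measurable_continuous_onI continuous_intros)

lemma fourier_transform_eq: "fourier_transform \<mu> \<xi> = (\<integral>x. phase (\<xi> \<bullet> x) \<partial>\<mu>)"
  by (simp add: fourier_transform_def phase_def)

abbreviation unit_uniform :: "real measure" where
  "unit_uniform \<equiv> restrict_space lborel {0..1}"

lemma prob_space_unit_uniform: "prob_space unit_uniform"
  by (rule prob_spaceI) (simp add: emeasure_restrict_space space_restrict_space)

lemma borel_measurable_phase_unit_uniform:
  "(\<lambda>u. phase (v * u)) \<in> borel_measurable unit_uniform"
  by (rule measurable_restrict_space1) measurable

lemma (in finite_measure) integrable_phase:
  assumes "f \<in> borel_measurable M"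
  shows "integrable M (\<lambda>x. phase (f x))"
  by (rule integrable_const_bound[where B = 1]) (use assms in auto)

lemma (in prob_space) norm_integral_le_1:
  fixes f :: "'a \<Rightarrow> complex"
  assumes "\<And>x. x \<in> space M \<Longrightarrow> cmod (f x) \<le> 1"
  shows "cmod (\<integral>x. f x \<partial>M) \<le> 1"
proof -
  have "cmod (\<integral>x. f x \<partial>M) \<le> (\<integral>x. cmod (f x) \<partial>M)" by (rule integral_norm_bound)
  also have "\<dots> \<le> (\<integral>x. 1 \<partial>M)"
    by (rule integral_mono') (use assms in auto)
  finally show ?thesis by (simp add: prob_space)
qed

text \<open>
  The integral is elementary: $(e^{-2\pi i v} - 1) / (-2\pi i v)$, with numerator at most 2.
\<close>

lemma unit_uniform_phase_decay:
  assumes "v \<noteq> 0"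
  shows "cmod (\<integral>u. phase (v * u) \<partial>unit_uniform) \<le> 1 / (pi * \<bar>v\<bar>)"
proof -
  define c where "c = - 2 * of_real pi * \<i> * complex_of_real v"
  have c: "c \<noteq> 0" "cmod c = 2 * pi * \<bar>v\<bar>"
    using assms by (simp_all add: c_def norm_mult)
  have p: "phase (v * u) = exp (of_real u * c)" for u
    by (simp add: phase_def c_def mult_ac)
  have "(\<integral>u. phase (v * u) \<partial>unit_uniform) = (\<integral>u. indicator {0..1} u *\<^sub>R exp (of_real u * c) \<partial>lborel)"
    by (simp add: integral_restrict_space p)
  also have "\<dots> = exp (of_real 1 * c) / c - exp (of_real 0 * c) / c"
  proof (rule integral_FTC_atLeastAtMost)
    fix u :: real
    have "((\<lambda>u. exp (of_real u * c) / c) has_vector_derivative (exp (of_real u * c) * c / c)) (at u within {0..1})"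
      by (auto intro!: derivative_eq_intros has_vector_derivative_real_field simp: c)
    then show "((\<lambda>u. exp (of_real u * c) / c) has_vector_derivative exp (of_real u * c)) (at u within {0..1})"
      using c by simp
  qed (auto intro!: continuous_intros)
  also have "\<dots> = (phase v - 1) / c"
    using p[of 1] by (simp add: diff_divide_distrib)
  finally have "cmod (\<integral>u. phase (v * u) \<partial>unit_uniform) = cmod (phase v - 1) / (2 * pi * \<bar>v\<bar>)"
    by (simp add: norm_divide c)
  also have "\<dots> \<le> 2 / (2 * pi * \<bar>v\<bar>)"
    using norm_triangle_ineq4[of "phase v" 1] by (intro divide_right_mono) auto
  finally show ?thesis by simp
qed

text \<open>
  A smooth density on the unit interval with rapidly decaying Fourier transform is replaced by the law
  of the average of $N$ independent uniform variables: it lives on the same interval and its transform,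
  an $N$-th power, decays like $|v|^{-N}$. A point of the averaging space is a $k \times N$ matrix of
  independent uniform entries, and its $k$ row averages are a random point of the unit cube.
\<close>

definition averaging_space :: "nat \<Rightarrow> nat \<Rightarrow> (nat \<times> nat \<Rightarrow> real) measure" where
  "averaging_space k N = Pi\<^sub>M ({1..k} \<times> {1..N}) (\<lambda>_. unit_uniform)"

definition row_average :: "nat \<Rightarrow> (nat \<times> nat \<Rightarrow> real) \<Rightarrow> nat \<Rightarrow> real" where
  "row_average N u i = (\<Sum>j=1..N. u (i, j)) / real N"

lemma prob_space_averaging_space: "prob_space (averaging_space k N)"
  unfolding averaging_space_def by (intro prob_space_PiM prob_space_unit_uniform)

lemma row_average_in_unit_interval:
  assumes "u \<in> space (averaging_space k N)" "i \<in> {1..k}" "0 < N"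
  shows "row_average N u i \<in> {0..1}"
proof -
  have u: "u (i, j) \<in> {0..1}" if "j \<in> {1..N}" for j
    using assms that by (auto simp: averaging_space_def space_PiM space_restrict_space PiE_iff)
  have "(\<Sum>j=1..N. u (i, j)) \<le> (\<Sum>j=1..N. 1)"
    using u by (intro sum_mono) auto
  moreover have "0 \<le> (\<Sum>j=1..N. u (i, j))"
    using u by (intro sum_nonneg) auto
  ultimately show ?thesis
    using assms(3) by (simp add: row_average_def)
qed

lemma borel_measurable_row_average [measurable]:
  assumes "i \<in> {1..k}"
  shows "(\<lambda>u. row_average N u i) \<in> borel_measurable (averaging_space k N)"
proof -
  have id: "(\<lambda>x. x) \<in> borel_measurable unit_uniform"
    by (rule measurable_restrict_space1) simp
  have "(\<lambda>u. u (i, j)) \<in> borel_measurable (averaging_space k N)" if "j \<in> {1..N}" for j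
    unfolding averaging_space_def
    by (rule measurable_compose[OF measurable_component_singleton[of "(i, j)" _ "\<lambda>_. unit_uniform"] id])
      (use assms that in auto)
  then show ?thesis
    unfolding row_average_def by measurable
qed

text \<open>
  By independence the integral is a product over all matrix entries. Each of the $N$ entries of row
  $i$ contributes a factor at most $N / (\pi |v_i|)$; all other factors have modulus at most 1. The
  scaling condition controls only the largest of the numbers $|v_i|$, so one good row has to
  suffice.
\<close>

lemma averaging_space_phase_decay:
  assumes i: "i \<in> {1..k}" and "v i \<noteq> 0" "0 < N"
  shows "cmod (\<integral>u. phase (\<Sum>i=1..k. row_average N u i * v i) \<partial>averaging_space k N)
    \<le> (real N / (pi * \<bar>v i\<bar>)) ^ N"
proof -
  interpret P: prob_space unit_uniform by (rule prob_space_unit_uniform)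
  interpret product_sigma_finite "\<lambda>_ :: nat \<times> nat. unit_uniform" ..
  \<comment> \<open>Bound for each entry of row \<open>l\<close>.\<close>
  define B where "B l = (if l = i then real N / (pi * \<bar>v i\<bar>) else 1)" for l
  have "phase (\<Sum>i=1..k. row_average N u i * v i)
      = (\<Prod>p\<in>{1..k} \<times> {1..N}. phase (v (fst p) / real N * u p))" for u
  proof -
    have "(\<Sum>i=1..k. row_average N u i * v i) = (\<Sum>i=1..k. \<Sum>j=1..N. v i / real N * u (i, j))"
      by (intro sum.cong) (simp_all add: row_average_def sum_divide_distrib sum_distrib_right sum_distrib_left mult_ac)
    also have "\<dots> = (\<Sum>p\<in>{1..k} \<times> {1..N}. v (fst p) / real N * u p)"
      by (simp add: sum.cartesian_product case_prod_unfold)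
    finally show ?thesis by (simp add: phase_sum)
  qed
  then have "(\<integral>u. phase (\<Sum>i=1..k. row_average N u i * v i) \<partial>averaging_space k N)
      = (\<Prod>p\<in>{1..k} \<times> {1..N}. \<integral>r. phase (v (fst p) / real N * r) \<partial>unit_uniform)"
    unfolding averaging_space_def
    by (simp only:) (intro product_integral_prod P.integrable_const_bound[where B = 1]
        finite_cartesian_product finite_atLeastAtMost borel_measurable_phase_unit_uniform, simp)
  then have "cmod (\<integral>u. phase (\<Sum>i=1..k. row_average N u i * v i) \<partial>averaging_space k N)
      = (\<Prod>p\<in>{1..k} \<times> {1..N}. cmod (\<integral>r. phase (v (fst p) / real N * r) \<partial>unit_uniform))"
    by (simp add: prod_norm)
  also have "\<dots> \<le> (\<Prod>p\<in>{1..k} \<times> {1..N}. B (fst p))"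
  proof (intro prod_mono conjI)
    fix p :: "nat \<times> nat"
    show "cmod (\<integral>r. phase (v (fst p) / real N * r) \<partial>unit_uniform) \<le> B (fst p)"
    proof (cases "fst p = i")
      case True
      then show ?thesis
        using unit_uniform_phase_decay[of "v i / real N"] assms by (simp add: B_def abs_divide)
    next
      case False
      then show ?thesis by (simp add: B_def P.norm_integral_le_1)
    qed
  qed simp
  also have "\<dots> = (\<Prod>l=1..k. B l ^ N)"
    using prod.cartesian_product[of "\<lambda>l _. B l" "{1..N}" "{1..k}"]
    by (simp add: case_prod_unfold)
  also have "\<dots> = (real N / (pi * \<bar>v i\<bar>)) ^ N"
    using i by (subst prod.remove[of _ i]) (auto simp: B_def)
  finally show ?thesis .
qed

section \<open>A measure on the set with decaying Fourier transform\<close>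

text \<open>
  The scaling measure is finite, because basis vectors have length 1 and so the slab of width 2 in any
  direction is the whole Grassmannian. Hence it can be normalised, on a Borel set $A \subseteq \Gamma$
  that carries it.
\<close>

lemma beta_scaling_prob_measure:
  fixes x :: "(real^'d) set \<Rightarrow> nat \<Rightarrow> real^'d"
  assumes "beta_scaling k x \<beta> \<Gamma>" and "orthonormal_basis_choice k x"
  obtains P A K where "prob_space P" "sets P = sets (grass_borel k)" "A \<in> sets P" "A \<subseteq> \<Gamma>" "A \<noteq> {}"
    "AE s in P. s \<in> A" "0 \<le> K"
    "\<And>\<xi> \<eta>. \<xi> \<noteq> 0 \<Longrightarrow> 0 < \<eta> \<Longrightarrow> emeasure P (slab k x \<xi> \<eta>) \<le> ennreal (K * \<eta> powr \<beta>)"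
proof -
  obtain \<gamma> A C where g: "sets \<gamma> = sets (grass_borel k)" "emeasure \<gamma> (space \<gamma>) \<noteq> 0"
      and A: "A \<in> sets \<gamma>" "A \<subseteq> \<Gamma>" "emeasure \<gamma> (space \<gamma> - A) = 0"
      and C: "0 < C" "\<And>\<xi> \<eta>. \<xi> \<noteq> 0 \<Longrightarrow> 0 < \<eta> \<Longrightarrow> emeasure \<gamma> (slab k x \<xi> \<eta>) \<le> ennreal (C * \<eta> powr \<beta>)"
    using assms(1) unfolding beta_scaling_def by blast
  have space: "space \<gamma> = grassmannian k"
    using sets_eq_imp_space_eq[OF g(1)] by (simp add: grass_borel_def space_measure_of_conv)
  have xm: "x s i \<bullet> x s i = 1" if "s \<in> grassmannian k" "i \<in> {1..k}" for s i
    using assms(2) that unfolding orthonormal_basis_choice_def by simp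
  have "emeasure \<gamma> (space \<gamma>) = emeasure \<gamma> A + emeasure \<gamma> (space \<gamma> - A)"
    using A(1) sets.sets_into_space[OF A(1)] by (subst plus_emeasure) (auto intro!: arg_cong[of _ _ "emeasure \<gamma>"])
  then have A0: "emeasure \<gamma> A = emeasure \<gamma> (space \<gamma>)" using A(3) by simp
  obtain \<xi> :: "real^'d" where \<xi>: "norm \<xi> = 1" using vector_choose_size[of 1] by auto
  have "slab k x \<xi> 2 = space \<gamma>"
    unfolding slab_def space
  proof (intro equalityI subsetI CollectI conjI ballI)
    fix s :: "(real^'d) set" and i assume "s \<in> grassmannian k" "i \<in> {1..k}"
    then have "norm (x s i) = 1" using xm by (simp add: norm_eq_sqrt_inner)
    then show "\<bar>\<xi> \<bullet> x s i\<bar> < 2 * norm \<xi>"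
      using Cauchy_Schwarz_ineq2[of \<xi> "x s i"] \<xi> by simp
  qed auto
  then have fin: "emeasure \<gamma> (space \<gamma>) < \<infinity>"
    using C(2)[of \<xi> 2] norm_zero \<xi>
    by (metis ennreal_less_top infinity_ennreal_def le_less_trans zero_less_numeral zero_neq_one)
  define P where "P = uniform_measure \<gamma> A"
  define m where "m = enn2real (emeasure \<gamma> A)"
  have m: "emeasure \<gamma> A = ennreal m" "0 < m"
    using A0 fin g(2) by (auto simp: m_def less_top enn2real_positive_iff zero_less_iff_neq_zero)
  show thesis
  proof (rule that[of P A "C / m"])
    show "prob_space P"
      unfolding P_def using A0 g(2) fin by (intro prob_space_uniform_measure) auto
    show "sets P = sets (grass_borel k)" "A \<in> sets P" "A \<subseteq> \<Gamma>"
      using g A by (auto simp: P_def)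
    show "A \<noteq> {}" using A0 g(2) by auto
    show "AE s in P. s \<in> A"
      unfolding P_def using A(1) by (intro AE_uniform_measureI) auto
    show "0 \<le> C / m" using C m by simp
    fix \<xi> :: "real^'d" and \<eta> :: real assume h: "\<xi> \<noteq> 0" "0 < \<eta>"
    show "emeasure P (slab k x \<xi> \<eta>) \<le> ennreal (C / m * \<eta> powr \<beta>)"
    proof (cases "slab k x \<xi> \<eta> \<in> sets \<gamma>")
      case True
      have "emeasure P (slab k x \<xi> \<eta>) = emeasure \<gamma> (A \<inter> slab k x \<xi> \<eta>) / ennreal m"
        unfolding P_def using A(1) True m by simp
      also have "\<dots> \<le> ennreal (C * \<eta> powr \<beta>) / ennreal m"
        using True A(1) C(2)[OF h]
        by (intro divide_right_mono_ennreal) (meson emeasure_mono inf_le2 order_trans)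
      also have "\<dots> = ennreal (C / m * \<eta> powr \<beta>)"
        using m C by (simp add: divide_ennreal)
      finally show ?thesis .
    next
      case False
      \<comment> \<open>\<open>emeasure\<close> is 0 outside the sigma-algebra.\<close>
      then show ?thesis by (simp add: P_def emeasure_notin_sets)
    qed
  qed
qed

text \<open>
  The measure is the law of $t(s) + \sum_i r_i x_i^s$, where $s$ is drawn from the scaling measure and
  $r$ is, independently, the random point of the unit cube given by the row averages of a $k \times N$
  uniform matrix with $N > \beta$. Integrating over $r$ first, the transform at $\xi$ of the cube
  belonging to $s$ is at most $\min(1, (c / a(s))^N)$, where $a(s)$ is the maximum of
  $|\xi \cdot x_i^s| / |\xi|$ over $i$ and $c = N / (\pi |\xi|)$. The slabs are the sublevel sets of
  $a$, so integrating over $s$ gives a constant times $c^\beta$.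

  The position $t(s)$ of the cube has to be chosen measurably. That the cube lies in $E$ for almost
  every $r$ is the vanishing of the mean (truncated) distance of its points from $E$, a quantity that is
  measurable in $s$ and Lipschitz in $t$, so that the selection lemma for zeros applies.
\<close>

theorem exists_measure_with_Fourier_decay:
  fixes x :: "(real^'d) set \<Rightarrow> nat \<Rightarrow> real^'d" and E :: "(real^'d) set"
  assumes "1 \<le> k" "0 \<le> \<beta>" and x: "orthonormal_basis_choice k x"
    and "beta_scaling k x \<beta> \<Gamma>" "compact E" and dk: "dkGamma_set k x \<Gamma> E"
  obtains \<mu> C where "prob_space \<mu>" "sets \<mu> = sets borel" "emeasure \<mu> (- E) = 0" "0 < C"
    "\<And>\<xi>. \<xi> \<noteq> 0 \<Longrightarrow> cmod (fourier_transform \<mu> \<xi>) \<le> C * norm \<xi> powr - \<beta>"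
proof -
  obtain P A K where P: "prob_space P" "sets P = sets (grass_borel k)"
    and A[measurable]: "A \<in> sets P" and A\<Gamma>: "A \<subseteq> \<Gamma>" "A \<noteq> {}"
    and PA: "AE s in P. s \<in> A" and K: "0 \<le> K"
      "\<And>\<xi> \<eta>. \<xi> \<noteq> 0 \<Longrightarrow> 0 < \<eta> \<Longrightarrow> emeasure P (slab k x \<xi> \<eta>) \<le> ennreal (K * \<eta> powr \<beta>)"
    using beta_scaling_prob_measure[OF assms(4) x] by metis
  have space: "space P = grassmannian k"
    using sets_eq_imp_space_eq[OF P(2)] by (simp add: grass_borel_def space_measure_of_conv)
  have xm[measurable]: "(\<lambda>s. x s i) \<in> borel_measurable P" if "i \<in> {1..k}" for i
    using x that P(2) unfolding orthonormal_basis_choice_def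
    by (simp cong: measurable_cong_sets)
  obtain N :: nat where N: "\<beta> < real N" using reals_Archimedean2 by blast
  then have N0: "0 < N" using \<open>0 \<le> \<beta>\<close> by (cases N) auto
  define \<Omega> where "\<Omega> = averaging_space k N"
  interpret S: prob_space P by fact
  interpret \<Omega>: prob_space \<Omega> unfolding \<Omega>_def by (rule prob_space_averaging_space)
  interpret PO: pair_prob_space P \<Omega> ..
  have am[measurable]: "(\<lambda>u. row_average N u i) \<in> borel_measurable \<Omega>" if "i \<in> {1..k}" for i
    unfolding \<Omega>_def using that by (rule borel_measurable_row_average)
  define w where "w s u = (\<Sum>i=1..k. row_average N u i *\<^sub>R x s i)" for s u
  have w[measurable]: "(\<lambda>(s, u). w s u) \<in> borel_measurable (P \<Otimes>\<^sub>M \<Omega>)"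
    unfolding w_def by measurable

  have inE: "\<exists>t. \<forall>r. (\<forall>i\<in>{1..k}. r i \<in> {0..1}) \<longrightarrow> t + (\<Sum>i=1..k. r i *\<^sub>R x s i) \<in> E" if "s \<in> A" for s
    using dk A\<Gamma> that unfolding dkGamma_set_def by blast
  \<comment> \<open>The vertex \<open>r = 0\<close> of the cube shows that the translation vector lies in \<open>E\<close>, hence in a compact set.\<close>
  have inE0: "t \<in> E" if "\<forall>r. (\<forall>i\<in>{1..k}. r i \<in> {0..1}) \<longrightarrow> t + (\<Sum>i=1..k. r i *\<^sub>R x s i) \<in> E" for s t
    using that[THEN spec, of "\<lambda>_. 0"] by simp
  have "E \<noteq> {}" using inE inE0 A\<Gamma>(2) by blast

  \<comment> \<open>The distance from \<open>E\<close> is truncated at 1 to make it integrable.\<close>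
  define h where "h v = min 1 (infdist v E)" for v
  have h[measurable]: "h \<in> borel_measurable borel"
    unfolding h_def by (intro borel_measurable_continuous_onI continuous_intros)
  have h01: "0 \<le> h v" "h v \<le> 1" for v
    by (simp_all add: h_def infdist_nonneg)
  have h0: "h v = 0 \<longleftrightarrow> v \<in> E" for v
    using in_closed_iff_infdist_zero[OF compact_imp_closed[OF \<open>compact E\<close>] \<open>E \<noteq> {}\<close>]
    by (auto simp: h_def min_def)
  have hint: "integrable \<Omega> (\<lambda>u. h (t + w s u))" if "s \<in> space P" for s t
    by (rule \<Omega>.integrable_const_bound[where B = 1])
      (use h01 that in \<open>auto simp: abs_of_nonneg\<close>)
  \<comment> \<open>Off \<open>A\<close> no translate is prescribed; there every point of \<open>E\<close> counts as a zero.\<close>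
  define F where "F s t = indicator A s * (\<integral>u. h (t + w s u) \<partial>\<Omega>)" for s t
  obtain t where t[measurable]: "t \<in> borel_measurable P" and Ft: "\<And>s. s \<in> space P \<Longrightarrow> F s (t s) = 0"
  proof (rule measurable_zero_selection[where F = F and M = P and C = E])
    show "(\<lambda>s. F s t) \<in> borel_measurable P" for t
      unfolding F_def by measurable
    show "0 \<le> F s t" for s t
      unfolding F_def using h01 by simp
    show "continuous_on UNIV (F s)" if s: "s \<in> space P" for s
    proof -
      have "\<bar>(\<integral>u. h (t + w s u) \<partial>\<Omega>) - (\<integral>u. h (t' + w s u) \<partial>\<Omega>)\<bar> \<le> dist t t'" for t t'
      proof -
        have "\<bar>h (t + w s u) - h (t' + w s u)\<bar> \<le> dist t t'" for u
          using infdist_triangle[of "t + w s u" E "t' + w s u"]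
            infdist_triangle[of "t' + w s u" E "t + w s u"]
          by (simp add: h_def min_def dist_norm norm_minus_commute) linarith
        then have "(\<integral>u. \<bar>h (t + w s u) - h (t' + w s u)\<bar> \<partial>\<Omega>) \<le> (\<integral>u. dist t t' \<partial>\<Omega>)"
          by (intro integral_mono Bochner_Integration.integrable_diff integrable_abs hint s) auto
        moreover have "\<bar>\<integral>u. h (t + w s u) - h (t' + w s u) \<partial>\<Omega>\<bar>
            \<le> (\<integral>u. \<bar>h (t + w s u) - h (t' + w s u)\<bar> \<partial>\<Omega>)"
          by (rule integral_abs_bound)
        ultimately show ?thesis
          using hint[OF s] by (simp add: \<Omega>.prob_space)
      qed
      then have "continuous_on UNIV (\<lambda>t. \<integral>u. h (t + w s u) \<partial>\<Omega>)"
        by (intro lipschitz_on_continuous_on[of 1] lipschitz_onI) (auto simp: dist_real_def)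
      then show ?thesis unfolding F_def by (intro continuous_intros)
    qed
    show "\<exists>t\<in>E. F s t = 0" if "s \<in> space P" for s
    proof (cases "s \<in> A")
      case True
      then obtain t where t: "\<And>r. (\<forall>i\<in>{1..k}. r i \<in> {0..1}) \<Longrightarrow> t + (\<Sum>i=1..k. r i *\<^sub>R x s i) \<in> E"
        using inE by blast
      have "t + w s u \<in> E" if "u \<in> space \<Omega>" for u
        unfolding w_def using that N0
        by (intro t ballI row_average_in_unit_interval) (auto simp: \<Omega>_def)
      then have "(\<integral>u. h (t + w s u) \<partial>\<Omega>) = (\<integral>u. 0 \<partial>\<Omega>)"
        using h0 by (intro Bochner_Integration.integral_cong) auto
      then show ?thesis
        using inE0 t by (intro bexI[of _ t]) (auto simp: F_def)
    next
      case False
      then show ?thesis using \<open>E \<noteq> {}\<close> by (auto simp: F_def)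
    qed
  qed (use \<open>compact E\<close> in auto)

  define \<Phi> where "\<Phi> = (\<lambda>(s, u). t s + w s u)"
  have \<Phi>[measurable]: "\<Phi> \<in> borel_measurable (P \<Otimes>\<^sub>M \<Omega>)"
    unfolding \<Phi>_def by measurable
  define \<mu> where "\<mu> = distr (P \<Otimes>\<^sub>M \<Omega>) borel \<Phi>"
  have Eb[measurable]: "E \<in> sets borel" using \<open>compact E\<close> by (simp add: borel_compact)
  have "AE s in P. AE u in \<Omega>. \<Phi> (s, u) \<in> E"
  proof (rule AE_mp[OF PA], rule AE_I2, rule impI)
    fix s assume s: "s \<in> space P" "s \<in> A"
    then have "(\<integral>u. h (t s + w s u) \<partial>\<Omega>) = 0" using Ft[OF s(1)] by (simp add: F_def)
    then have "AE u in \<Omega>. h (t s + w s u) = 0"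
      using hint[OF s(1)] h01 by (subst (asm) integral_nonneg_eq_0_iff_AE) auto
    then show "AE u in \<Omega>. \<Phi> (s, u) \<in> E" by (simp add: h0 \<Phi>_def)
  qed
  then have "AE z in P \<Otimes>\<^sub>M \<Omega>. \<Phi> z \<in> E"
    by (intro PO.AE_pair_measure) measurable
  then have "AE v in \<mu>. v \<in> E"
    unfolding \<mu>_def by (subst AE_distr_iff[OF \<Phi>]) simp_all
  then have "emeasure \<mu> {v \<in> space \<mu>. v \<notin> E} = 0"
    by (intro emeasure_eq_0_AE) simp
  then have \<mu>E: "emeasure \<mu> (- E) = 0"
    by (simp add: \<mu>_def Compl_eq)

  define D where "D = K * 2 powr \<beta> / (1 - 2 powr (\<beta> - real N)) * (real N / pi) powr \<beta>"
  have bound: "cmod (fourier_transform \<mu> \<xi>) \<le> D * norm \<xi> powr - \<beta>" if \<xi>: "\<xi> \<noteq> 0" for \<xi>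
  proof -
    define f where "f s = (\<integral>u. phase (\<xi> \<bullet> \<Phi> (s, u)) \<partial>\<Omega>)" for s
    define a where "a s = Max ((\<lambda>i. \<bar>\<xi> \<bullet> x s i\<bar>) ` {1..k}) / norm \<xi>" for s
    have int: "integrable (P \<Otimes>\<^sub>M \<Omega>) (\<lambda>z. phase (\<xi> \<bullet> \<Phi> z))"
      by (intro PO.integrable_phase) measurable
    have "fourier_transform \<mu> \<xi> = (\<integral>z. phase (\<xi> \<bullet> \<Phi> z) \<partial>(P \<Otimes>\<^sub>M \<Omega>))"
      unfolding fourier_transform_eq \<mu>_def by (subst integral_distr) auto
    also have "\<dots> = (\<integral>s. f s \<partial>P)"
      unfolding f_def by (rule PO.integral_fst'[OF int, symmetric])
    finally have "ennreal (cmod (fourier_transform \<mu> \<xi>)) \<le> (\<integral>\<^sup>+s. ennreal (cmod (f s)) \<partial>P)"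
      using integral_norm_bound_ennreal[OF PO.integrable_fst'[OF int]] by (simp add: f_def)
    also have "\<dots> \<le> ennreal (K * 2 powr \<beta> / (1 - 2 powr (\<beta> - real N))
        * (real N / (pi * norm \<xi>)) powr \<beta>)"
    proof (rule nn_integral_power_tail)
      show "a \<in> borel_measurable P" unfolding a_def by measurable
      show "0 < real N / (pi * norm \<xi>)" using N0 \<xi> by simp
      show "cmod (f s) \<le> 1" for s
        unfolding f_def by (rule \<Omega>.norm_integral_le_1) simp
    next
      fix \<eta> :: real assume "0 < \<eta>"
      have "{s \<in> space P. a s < \<eta>} = slab k x \<xi> \<eta>"
        using \<open>1 \<le> k\<close> \<xi> by (auto simp: slab_def space a_def divide_less_eq)
      then show "emeasure P {s \<in> space P. a s < \<eta>} \<le> ennreal (K * \<eta> powr \<beta>)"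
        using K(2)[OF \<xi> \<open>0 < \<eta>\<close>] by simp
    next
      fix s assume s: "s \<in> space P" "0 < a s"
      have "Max ((\<lambda>i. \<bar>\<xi> \<bullet> x s i\<bar>) ` {1..k}) \<in> (\<lambda>i. \<bar>\<xi> \<bullet> x s i\<bar>) ` {1..k}"
        using \<open>1 \<le> k\<close> by (intro Max_in) auto
      then obtain i where i: "i \<in> {1..k}" "a s = \<bar>\<xi> \<bullet> x s i\<bar> / norm \<xi>"
        by (auto simp: a_def)
      have "phase (\<xi> \<bullet> \<Phi> (s, u)) = phase (\<xi> \<bullet> t s) * phase (\<Sum>i=1..k. row_average N u i * (\<xi> \<bullet> x s i))" for u
        by (simp add: \<Phi>_def w_def inner_add_right inner_sum_right phase_add)
      then have "f s = phase (\<xi> \<bullet> t s) * (\<integral>u. phase (\<Sum>i=1..k. row_average N u i * (\<xi> \<bullet> x s i)) \<partial>\<Omega>)"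
        by (simp add: f_def)
      then have "cmod (f s) = cmod (\<integral>u. phase (\<Sum>i=1..k. row_average N u i * (\<xi> \<bullet> x s i)) \<partial>\<Omega>)"
        by (simp add: norm_mult)
      also have "\<dots> \<le> (real N / (pi * \<bar>\<xi> \<bullet> x s i\<bar>)) ^ N"
        unfolding \<Omega>_def using i s(2) N0 by (intro averaging_space_phase_decay) auto
      also have "real N / (pi * \<bar>\<xi> \<bullet> x s i\<bar>) = real N / (pi * norm \<xi>) / a s"
        using i \<xi> by simp
      also have "(real N / (pi * norm \<xi>) / a s) ^ N = (real N / (pi * norm \<xi>) / a s) powr real N"
        using s(2) N0 \<xi> by (intro powr_realpow[symmetric]) simp
      finally show "cmod (f s) \<le> (real N / (pi * norm \<xi>) / a s) powr real N" .
    qed (use N K in auto)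
    also have "(real N / (pi * norm \<xi>)) powr \<beta> = (real N / pi) powr \<beta> * norm \<xi> powr - \<beta>"
      by (simp add: powr_divide powr_mult powr_minus_divide)
    finally have "ennreal (cmod (fourier_transform \<mu> \<xi>)) \<le> ennreal (D * norm \<xi> powr - \<beta>)"
      by (simp add: D_def mult_ac)
    moreover have "0 \<le> D"
      using K(1) N by (simp add: D_def powr_le_one_le powr_less_one less_imp_le)
    ultimately show ?thesis by (simp add: ennreal_le_iff)
  qed
  \<comment> \<open>\<open>D\<close> itself may be 0, when \<open>K = 0\<close>.\<close>
  show thesis
  proof (rule that[of \<mu> "\<bar>D\<bar> + 1"])
    show "prob_space \<mu>" unfolding \<mu>_def by (rule PO.prob_space_distr) measurable
    show "cmod (fourier_transform \<mu> \<xi>) \<le> (\<bar>D\<bar> + 1) * norm \<xi> powr - \<beta>" if "\<xi> \<noteq> 0" for \<xi>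
      by (rule order_trans[OF bound[OF that]]) (intro mult_right_mono, auto)
  qed (auto simp: \<mu>_def \<mu>E[unfolded \<mu>_def])
qed

section \<open>The Fourier transform of Gaussians\<close>

text \<open>
  The characteristic function of the standard normal law, rescaled by $c = \sqrt{2\pi}\,\delta$ and
  evaluated at $-2\pi z / c$.
\<close>

lemma gaussian_fourier_real:
  fixes \<delta> z :: real
  assumes "0 < \<delta>"
  shows "(\<integral>y. of_real (exp (- pi * \<delta>\<^sup>2 * y\<^sup>2)) * phase (y * z) \<partial>lborel)
    = of_real (exp (- pi * z\<^sup>2 / \<delta>\<^sup>2) / \<delta>)"
proof -
  define c where "c = sqrt (2 * pi) * \<delta>"
  have c: "0 < c" "c\<^sup>2 = 2 * pi * \<delta>\<^sup>2" and c': "c / sqrt (2 * pi) = \<delta>"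
    using assms by (auto simp: c_def power_mult_distrib)
  define t where "t = - 2 * pi * z / c"
  have t2: "- (t\<^sup>2) / 2 = - pi * z\<^sup>2 / \<delta>\<^sup>2"
    using c assms by (simp add: t_def power_divide power_mult_distrib power2_eq_square field_simps)
  have tc: "t * (c * y) = - 2 * pi * (y * z)" for y
    using c(1) by (simp add: t_def)
  have "of_real (exp (- (t\<^sup>2) / 2)) = char std_normal_distribution t"
    by (simp add: char_std_normal_distribution)
  also have "\<dots> = (\<integral>x. std_normal_density x *\<^sub>R cis (t * x) \<partial>lborel)"
    unfolding char_def by (subst integral_density) (auto simp: cis_conv_exp mult_ac)
  also have "\<dots> = c *\<^sub>R (\<integral>y. std_normal_density (0 + c * y) *\<^sub>R cis (t * (0 + c * y)) \<partial>lborel)"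
    using c(1) by (subst lborel_integral_real_affine[where c = c and t = 0]) auto
  also have "\<dots> = (\<integral>y. of_real \<delta> * (of_real (exp (- pi * \<delta>\<^sup>2 * y\<^sup>2)) * phase (y * z)) \<partial>lborel)"
    unfolding integral_scaleR_right[symmetric]
  proof (rule Bochner_Integration.integral_cong)
    fix y :: real
    have "c * std_normal_density (c * y) = c / sqrt (2 * pi) * exp (- pi * \<delta>\<^sup>2 * y\<^sup>2)"
      by (simp add: std_normal_density_def power_mult_distrib c(2))
    then have "c * std_normal_density (c * y) = \<delta> * exp (- pi * \<delta>\<^sup>2 * y\<^sup>2)"
      by (simp only: c')
    moreover have "cis (t * (c * y)) = phase (y * z)"
      unfolding tc phase_eq_cis ..
    ultimately show "c *\<^sub>R (std_normal_density (0 + c * y) *\<^sub>R cis (t * (0 + c * y)))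
        = of_real \<delta> * (of_real (exp (- pi * \<delta>\<^sup>2 * y\<^sup>2)) * phase (y * z))"
      by (simp only: scaleR_scaleR add_0) (simp add: scaleR_conv_of_real)
  qed simp
  also have "\<dots> = of_real \<delta> * (\<integral>y. of_real (exp (- pi * \<delta>\<^sup>2 * y\<^sup>2)) * phase (y * z) \<partial>lborel)"
    by simp
  finally show ?thesis
    using assms unfolding t2 by (simp add: field_simps)
qed

text \<open>
  Lebesgue measure is the product of its one-dimensional coordinates, so Fubini factorises integrals
  of product functions.
\<close>

lemma lborel_integral_prod_Basis:
  fixes g :: "'a::euclidean_space \<Rightarrow> real \<Rightarrow> complex"
  assumes g: "\<And>b. b \<in> Basis \<Longrightarrow> integrable lborel (g b)"
  shows "(\<integral>x. (\<Prod>b\<in>Basis. g b (x \<bullet> b)) \<partial>lborel) = (\<Prod>b\<in>Basis. \<integral>r. g b r \<partial>lborel)"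
proof -
  interpret product_sigma_finite "\<lambda>_ :: 'a. lborel :: real measure" ..
  have [measurable]: "g b \<in> borel_measurable borel" if "b \<in> Basis" for b
    using borel_measurable_integrable[OF g[OF that]] by simp
  have "(\<integral>x. (\<Prod>b\<in>Basis. g b (x \<bullet> b)) \<partial>(lborel :: 'a measure))
      = (\<integral>f. (\<Prod>b\<in>Basis. g b ((\<Sum>b\<in>Basis. f b *\<^sub>R b) \<bullet> b)) \<partial>(\<Pi>\<^sub>M b\<in>(Basis :: 'a set). lborel))"
    by (subst lborel_eq, subst integral_distr) measurable
  also have "\<dots> = (\<integral>f. (\<Prod>b\<in>Basis. g b (f b)) \<partial>(\<Pi>\<^sub>M b\<in>(Basis :: 'a set). lborel))"
    by (intro Bochner_Integration.integral_cong refl prod.cong) (simp add: inner_sum_left_Basis)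
  also have "\<dots> = (\<Prod>b\<in>Basis. \<integral>r. g b r \<partial>lborel)"
    by (intro product_integral_prod g finite_Basis)
  finally show ?thesis .
qed

lemma gaussian_fourier:
  fixes z :: "'a::euclidean_space"
  assumes "0 < \<delta>"
  shows "(\<integral>\<xi>. of_real (exp (- pi * \<delta>\<^sup>2 * (norm \<xi>)\<^sup>2)) * phase (\<xi> \<bullet> z) \<partial>lborel)
    = of_real (exp (- pi * (norm z)\<^sup>2 / \<delta>\<^sup>2) / \<delta> ^ DIM('a))"
proof -
  define g where "g b r = of_real (exp (- pi * \<delta>\<^sup>2 * r\<^sup>2)) * phase (r * (z \<bullet> b))" for b r
  have g: "(\<integral>r. g b r \<partial>lborel) = of_real (exp (- pi * (z \<bullet> b)\<^sup>2 / \<delta>\<^sup>2) / \<delta>)" for b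
    unfolding g_def by (rule gaussian_fourier_real[OF assms])
  have int: "integrable lborel (g b)" for b
  \<comment> \<open>The value just computed is not 0, the conventional value for non-integrable functions.\<close>
  proof (rule ccontr)
    assume "\<not> integrable lborel (g b)"
    then have "(\<integral>r. g b r \<partial>lborel) = 0" by (rule not_integrable_integral_eq)
    then show False using g[of b] assms by (simp del: of_real_divide)
  qed
  have n: "(norm w)\<^sup>2 = (\<Sum>b\<in>Basis. (w \<bullet> b)\<^sup>2)" for w :: 'a
    by (subst euclidean_dist_l2[of w 0, simplified dist_0_norm, simplified])
       (simp add: L2_set_def sum_nonneg)
  have "of_real (exp (- pi * \<delta>\<^sup>2 * (norm \<xi>)\<^sup>2)) * phase (\<xi> \<bullet> z) = (\<Prod>b\<in>Basis. g b (\<xi> \<bullet> b))" for \<xi> :: 'a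
    by (simp add: g_def prod.distrib n sum_distrib_left exp_sum euclidean_inner[of \<xi> z]
        phase_sum sum_negf[symmetric] of_real_prod[symmetric] del: of_real_prod)
  then have "(\<integral>\<xi>. of_real (exp (- pi * \<delta>\<^sup>2 * (norm \<xi>)\<^sup>2)) * phase (\<xi> \<bullet> z) \<partial>lborel)
      = (\<Prod>b\<in>Basis. \<integral>r. g b r \<partial>lborel)"
    using lborel_integral_prod_Basis[of g, OF int] by simp
  also have "\<dots> = of_real (\<Prod>b\<in>(Basis::'a set). exp (- pi * (z \<bullet> b)\<^sup>2 / \<delta>\<^sup>2) / \<delta>)"
    unfolding g by simp
  also have "(\<Prod>b\<in>(Basis::'a set). exp (- pi * (z \<bullet> b)\<^sup>2 / \<delta>\<^sup>2) / \<delta>)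
      = exp (- pi * (norm z)\<^sup>2 / \<delta>\<^sup>2) / \<delta> ^ DIM('a)"
    by (simp add: prod_dividef n sum_distrib_left exp_sum sum_divide_distrib sum_negf[symmetric])
  finally show ?thesis .
qed

text \<open>
  A non-integrable function would have integral 0 by convention, whereas the transform at 0 is not 0.
\<close>

lemma integrable_gaussian:
  assumes "0 < \<delta>"
  shows "integrable lborel (\<lambda>\<xi>::'a::euclidean_space. exp (- pi * \<delta>\<^sup>2 * (norm \<xi>)\<^sup>2))"
proof (rule ccontr)
  assume n: "\<not> integrable lborel (\<lambda>\<xi>::'a. exp (- pi * \<delta>\<^sup>2 * (norm \<xi>)\<^sup>2))"
  have "(\<integral>\<xi>. exp (- pi * \<delta>\<^sup>2 * (norm (\<xi> :: 'a))\<^sup>2) \<partial>lborel) = 0"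
    using n by (rule not_integrable_integral_eq)
  then have "complex_of_real (1 / \<delta> ^ DIM('a)) = 0"
    using gaussian_fourier[OF assms, of "0::'a"] by (simp del: of_real_divide)
  then show False using assms by simp
qed

section \<open>Square integrable Fourier transforms and positive Lebesgue measure\<close>

text \<open>
  Write the Gaussian $\delta^{-d} e^{-\pi |x - y|^2 / \delta^2}$ as the Fourier integral of
  $e^{-\pi \delta^2 |\xi|^2}$, integrate against $\mu(dx)\,\mu(dy)$, and exchange the integrals: for
  fixed $\xi$ the double integral of $e^{-2\pi i \xi \cdot (x - y)}$ is
  $\hat\mu(\xi) \overline{\hat\mu(\xi)}$. The Gaussian factor makes everything absolutely integrable.
\<close>

lemma gaussian_energy:
  fixes \<mu> :: "(real^'d) measure"
  assumes "prob_space \<mu>" and sets[measurable_cong]: "sets \<mu> = sets borel" and \<delta>: "0 < \<delta>"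
  shows "integrable lborel (\<lambda>\<xi>. exp (- pi * \<delta>\<^sup>2 * (norm \<xi>)\<^sup>2) * (cmod (fourier_transform \<mu> \<xi>))\<^sup>2)"
      (is ?integrable)
    and "(\<integral>z. exp (- pi * (norm (fst z - snd z))\<^sup>2 / \<delta>\<^sup>2) / \<delta> ^ CARD('d) \<partial>(\<mu> \<Otimes>\<^sub>M \<mu>))
      = (\<integral>\<xi>. exp (- pi * \<delta>\<^sup>2 * (norm \<xi>)\<^sup>2) * (cmod (fourier_transform \<mu> \<xi>))\<^sup>2 \<partial>lborel)"
      (is ?eq)
proof -
  interpret M: prob_space \<mu> by fact
  interpret MM: pair_prob_space \<mu> \<mu> ..
  interpret QL: pair_sigma_finite "\<mu> \<Otimes>\<^sub>M \<mu>" "lborel :: (real^'d) measure" ..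
  define G where "G \<xi> = exp (- pi * \<delta>\<^sup>2 * (norm \<xi>)\<^sup>2)" for \<xi> :: "real^'d"
  have Gm[measurable]: "G \<in> borel_measurable borel"
    unfolding G_def by measurable
  have Gint: "integrable lborel G"
    unfolding G_def by (rule integrable_gaussian[OF \<delta>])
  have G0: "0 \<le> G \<xi>" for \<xi> by (simp add: G_def)
  define g where "g z \<xi> = complex_of_real (G \<xi>) * phase (\<xi> \<bullet> (fst z - snd z))" for z \<xi>
  have gm: "(\<lambda>(z, \<xi>). g z \<xi>) \<in> borel_measurable ((\<mu> \<Otimes>\<^sub>M \<mu>) \<Otimes>\<^sub>M lborel)"
    unfolding g_def by measurable
  have gn: "cmod (g z \<xi>) = G \<xi>" for z \<xi>
    by (simp add: g_def norm_mult G0)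
  have gint: "integrable ((\<mu> \<Otimes>\<^sub>M \<mu>) \<Otimes>\<^sub>M lborel) (\<lambda>(z, \<xi>). g z \<xi>)"
  proof (rule QL.Fubini_integrable[OF gm])
    show "AE z in \<mu> \<Otimes>\<^sub>M \<mu>. integrable lborel (\<lambda>\<xi>. case (z, \<xi>) of (z, \<xi>) \<Rightarrow> g z \<xi>)"
    proof (rule AE_I2)
      fix z
      have "(\<lambda>\<xi>. g z \<xi>) \<in> borel_measurable lborel"
        unfolding g_def by measurable
      then show "integrable lborel (\<lambda>\<xi>. case (z, \<xi>) of (z, \<xi>) \<Rightarrow> g z \<xi>)"
        using Gint by (subst integrable_norm_iff[symmetric]) (simp_all add: gn)
    qed
  qed (simp add: gn)
  have inner1: "(\<integral>z. g z \<xi> \<partial>(\<mu> \<Otimes>\<^sub>M \<mu>)) = of_real (G \<xi> * (cmod (fourier_transform \<mu> \<xi>))\<^sup>2)" for \<xi>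
  proof -
    have "(\<integral>z. phase (\<xi> \<bullet> (fst z - snd z)) \<partial>(\<mu> \<Otimes>\<^sub>M \<mu>))
        = (\<integral>x. \<integral>y. phase (\<xi> \<bullet> (fst (x, y) - snd (x, y))) \<partial>\<mu> \<partial>\<mu>)"
      by (intro MM.integral_fst'[symmetric] MM.integrable_phase) measurable
    also have "\<dots> = (\<integral>x. phase (\<xi> \<bullet> x) * (\<integral>y. cnj (phase (\<xi> \<bullet> y)) \<partial>\<mu>) \<partial>\<mu>)"
    proof -
      have "phase (\<xi> \<bullet> (x - y)) = phase (\<xi> \<bullet> x) * cnj (phase (\<xi> \<bullet> y))" for x y
        using phase_add[of "\<xi> \<bullet> x" "- (\<xi> \<bullet> y)"] by (simp add: inner_diff_right cnj_phase)
      then show ?thesis by simp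
    qed
    also have "\<dots> = fourier_transform \<mu> \<xi> * cnj (fourier_transform \<mu> \<xi>)"
      by (simp add: fourier_transform_eq)
    also have "\<dots> = of_real ((cmod (fourier_transform \<mu> \<xi>))\<^sup>2)"
      by (simp add: complex_norm_square[symmetric])
    finally show ?thesis by (simp add: g_def)
  qed
  have inner2: "(\<integral>\<xi>. g z \<xi> \<partial>lborel)
      = of_real (exp (- pi * (norm (fst z - snd z))\<^sup>2 / \<delta>\<^sup>2) / \<delta> ^ CARD('d))" for z
    unfolding g_def G_def using gaussian_fourier[OF \<delta>, of "fst z - snd z"] by simp
  have "integrable lborel (\<lambda>\<xi>. complex_of_real (G \<xi> * (cmod (fourier_transform \<mu> \<xi>))\<^sup>2))"
    using QL.integrable_snd[OF gint] by (simp only: inner1)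
  then show ?integrable by (simp only: complex_of_real_integrable_eq G_def)
  have "(\<integral>\<xi>. \<integral>z. g z \<xi> \<partial>(\<mu> \<Otimes>\<^sub>M \<mu>) \<partial>lborel) = (\<integral>z. \<integral>\<xi>. g z \<xi> \<partial>lborel \<partial>(\<mu> \<Otimes>\<^sub>M \<mu>))"
    by (rule QL.Fubini_integral[OF gint])
  then show ?eq
    unfolding inner1 inner2 integral_complex_of_real of_real_eq_iff G_def by (rule sym)
qed

text \<open>
  The Gaussian at scale $\delta$ is at least $e^{-4\pi}$ where $|x - y| < 2\delta$, and in the energy
  identity the factor $e^{-\pi \delta^2 |\xi|^2}$ is at most 1. Hence the bound is uniform in
  $\delta$.
\<close>

lemma near_diagonal_mass:
  fixes \<mu> :: "(real^'d) measure"
  assumes "prob_space \<mu>" and sets[measurable_cong]: "sets \<mu> = sets borel"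
    and B: "(\<integral>\<^sup>+\<xi>. ennreal ((cmod (fourier_transform \<mu> \<xi>))\<^sup>2) \<partial>lborel) \<le> ennreal B" "0 \<le> B"
    and \<delta>: "0 < \<delta>"
  shows "emeasure (\<mu> \<Otimes>\<^sub>M \<mu>) {z. dist (fst z) (snd z) < 2 * \<delta>} \<le> ennreal (exp (4 * pi) * B * \<delta> ^ CARD('d))"
proof -
  interpret M: prob_space \<mu> by fact
  interpret MM: pair_prob_space \<mu> \<mu> ..
  have sp: "space \<mu> = UNIV" using sets_eq_imp_space_eq[OF sets] by simp
  let ?Q = "\<mu> \<Otimes>\<^sub>M \<mu>"
  define S where "S = {z :: (real^'d) \<times> (real^'d). dist (fst z) (snd z) < 2 * \<delta>}"
  have "{z \<in> space ?Q. dist (fst z) (snd z) < 2 * \<delta>} \<in> sets ?Q" by measurable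
  then have S[measurable]: "S \<in> sets ?Q"
    by (simp add: S_def space_pair_measure sp)
  define e where "e z = exp (- pi * (norm (fst z - snd z))\<^sup>2 / \<delta>\<^sup>2)" for z :: "(real^'d) \<times> (real^'d)"
  have em[measurable]: "e \<in> borel_measurable ?Q" unfolding e_def by measurable
  have e1: "e z \<le> 1" for z by (simp add: e_def)
  have eint: "integrable ?Q e"
    by (rule MM.integrable_const_bound[where B = 1]) (use e1 in \<open>auto simp: e_def\<close>)
  have "exp (- (4 * pi)) * indicator S z \<le> e z" for z
  proof (cases "z \<in> S")
    case True
    then have "(norm (fst z - snd z))\<^sup>2 \<le> (2 * \<delta>)\<^sup>2"
      by (intro power_mono) (auto simp: S_def dist_norm)
    then have "pi * ((norm (fst z - snd z))\<^sup>2 / \<delta>\<^sup>2) \<le> pi * 4"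
      using \<delta> by (intro mult_left_mono) (auto simp: divide_le_eq power_mult_distrib)
    then show ?thesis using True by (simp add: e_def)
  qed (simp add: e_def)
  then have "(\<integral>z. exp (- (4 * pi)) * indicator S z \<partial>?Q) \<le> (\<integral>z. e z \<partial>?Q)"
    using S by (intro integral_mono eint integrable_mult_right integrable_real_indicator)
      (auto simp: MM.emeasure_eq_measure)
  then have "exp (- (4 * pi)) * measure ?Q S \<le> (\<integral>z. e z \<partial>?Q)"
    using S by (simp add: space_pair_measure sp)
  also have "(\<integral>z. e z \<partial>?Q)
      = (\<integral>\<xi>. exp (- pi * \<delta>\<^sup>2 * (norm \<xi>)\<^sup>2) * (cmod (fourier_transform \<mu> \<xi>))\<^sup>2 \<partial>lborel) * \<delta> ^ CARD('d)"
    using gaussian_energy(2)[OF assms(1) sets \<delta>] \<delta> by (simp add: e_def field_simps)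
  also have "\<dots> \<le> B * \<delta> ^ CARD('d)"
  proof (intro mult_right_mono)
    have "ennreal (\<integral>\<xi>. exp (- pi * \<delta>\<^sup>2 * (norm \<xi>)\<^sup>2) * (cmod (fourier_transform \<mu> \<xi>))\<^sup>2 \<partial>lborel)
        = (\<integral>\<^sup>+\<xi>. ennreal (exp (- pi * \<delta>\<^sup>2 * (norm \<xi>)\<^sup>2) * (cmod (fourier_transform \<mu> \<xi>))\<^sup>2) \<partial>lborel)"
      by (intro nn_integral_eq_integral[symmetric] gaussian_energy(1) assms) auto
    also have "\<dots> \<le> (\<integral>\<^sup>+\<xi>. ennreal ((cmod (fourier_transform \<mu> \<xi>))\<^sup>2) \<partial>lborel)"
      by (intro nn_integral_mono ennreal_leI mult_left_le_one_le) auto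
    also have "\<dots> \<le> ennreal B" by (rule B)
    finally show "(\<integral>\<xi>. exp (- pi * \<delta>\<^sup>2 * (norm \<xi>)\<^sup>2) * (cmod (fourier_transform \<mu> \<xi>))\<^sup>2 \<partial>lborel) \<le> B"
      using B(2) by simp
  qed (use \<delta> in auto)
  finally have "measure ?Q S \<le> exp (4 * pi) * B * \<delta> ^ CARD('d)"
    by (simp add: exp_minus field_simps)
  then show ?thesis
    unfolding S_def[symmetric] by (simp add: MM.emeasure_eq_measure ennreal_leI)
qed

text \<open>
  Let $f(x)$ be the $\mu$-mass of the ball of radius $\delta$ about $x$. By Fubini its integral is the
  volume $b$ of such a ball, and the integral of $f^2$ is at most $b$ times the mass of
  $\mu \times \mu$ within distance $2\delta$ of the diagonal, hence at most $b D \delta^d$. For small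
  $\delta$ the function $f$ is supported in a given open set $U \supseteq E$, so by Cauchy-Schwarz
  $b^2 \le b D \delta^d |U|$. As $b$ is itself a multiple of $\delta^d$, this bounds $|U|$ from below
  independently of $U$, which is impossible for small $U$ around a null set.
\<close>

lemma emeasure_lebesgue_pos_if_near_diagonal_mass:
  fixes \<mu> :: "'a::euclidean_space measure"
  assumes "prob_space \<mu>" and sets[measurable_cong]: "sets \<mu> = sets borel"
    and E: "compact E" "emeasure \<mu> (- E) = 0" and "0 \<le> D"
    and diag: "\<And>\<delta>. 0 < \<delta> \<Longrightarrow>
      emeasure (\<mu> \<Otimes>\<^sub>M \<mu>) {z. dist (fst z) (snd z) < 2 * \<delta>} \<le> ennreal (D * \<delta> ^ DIM('a))"
  shows "0 < emeasure lebesgue E"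
proof (rule ccontr)
  interpret M: prob_space \<mu> by fact
  interpret MM: pair_prob_space \<mu> \<mu> ..
  interpret QL: pair_sigma_finite "\<mu> \<Otimes>\<^sub>M \<mu>" "lborel :: 'a measure" ..
  interpret LM: pair_sigma_finite "lborel :: 'a measure" \<mu> ..
  have sp: "space \<mu> = UNIV" using sets_eq_imp_space_eq[OF sets] by simp
  assume "\<not> 0 < emeasure lebesgue E"
  then have E0: "emeasure lebesgue E = 0" by (simp add: zero_less_iff_neq_zero)
  define \<omega> where "\<omega> = unit_ball_vol (real DIM('a))"
  have \<omega>: "0 < \<omega>" by (simp add: \<omega>_def)
  \<comment> \<open>Any \<open>\<epsilon>\<close> with \<open>D * \<epsilon> < \<omega>\<close> contradicts the final estimate.\<close>
  define \<epsilon> where "\<epsilon> = \<omega> / (2 * (D + 1))"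
  have \<epsilon>: "0 < \<epsilon>" using \<omega> \<open>0 \<le> D\<close> by (simp add: \<epsilon>_def)
  have EL: "E \<in> sets lebesgue" using E(1) by (simp add: lmeasurable_compact fmeasurableD)
  obtain U where U: "open U" "E \<subseteq> U" "emeasure lebesgue (U - E) < ennreal \<epsilon>"
    using sets_lebesgue_outer_open[OF EL \<epsilon>] by metis
  have Um[measurable]: "U \<in> sets borel" using U(1) by simp
  have "emeasure lebesgue U \<le> emeasure lebesgue E + emeasure lebesgue (U - E)"
    using emeasure_subadditive[of E lebesgue "U - E"] EL U by (simp add: Un_absorb1 sets.Diff)
  then have U\<epsilon>: "emeasure lborel U \<le> ennreal \<epsilon>"
    using U(3) E0 by simp
  obtain \<delta> where \<delta>: "0 < \<delta>" "(\<Union>x\<in>E. ball x \<delta>) \<subseteq> U"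
    using compact_subset_open_imp_ball_epsilon_subset[OF E(1) U(1,2)] by metis
  define b where "b = \<omega> * \<delta> ^ DIM('a)"
  have b: "0 < b" using \<omega> \<delta> by (simp add: b_def)
  have ball: "emeasure lborel (ball y \<delta>) = ennreal b" for y :: 'a
    using \<delta>(1) by (simp add: emeasure_ball b_def \<omega>_def)
  define f where "f x = emeasure \<mu> (ball x \<delta>)" for x
  have f_eq: "f x = (\<integral>\<^sup>+y. indicator (ball y \<delta>) x \<partial>\<mu>)" for x
  proof -
    have "f x = (\<integral>\<^sup>+y. indicator (ball x \<delta>) y \<partial>\<mu>)"
      unfolding f_def by (rule nn_integral_indicator[symmetric]) (simp add: sets)
    also have "\<dots> = (\<integral>\<^sup>+y. indicator (ball y \<delta>) x \<partial>\<mu>)"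
      by (intro nn_integral_cong) (simp add: indicator_def dist_commute)
    finally show ?thesis .
  qed
  have ind[measurable]: "(\<lambda>(x, y). indicator (ball y \<delta>) x :: ennreal) \<in> borel_measurable (lborel \<Otimes>\<^sub>M \<mu>)"
    unfolding indicator_def mem_ball by measurable
  have fm[measurable]: "f \<in> borel_measurable borel"
    unfolding f_eq[abs_def] using M.borel_measurable_nn_integral[OF ind] by simp
  have total: "(\<integral>\<^sup>+x. f x \<partial>lborel) = ennreal b"
  proof -
    have "(\<integral>\<^sup>+x. f x \<partial>lborel) = (\<integral>\<^sup>+y. \<integral>\<^sup>+x. indicator (ball y \<delta>) x \<partial>lborel \<partial>\<mu>)"
      unfolding f_eq by (rule LM.Fubini'[OF ind, symmetric])
    also have "\<dots> = ennreal b" by (simp add: ball M.emeasure_space_1)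
    finally show ?thesis .
  qed
  have supp: "f x = f x * indicator U x" for x
  proof (cases "x \<in> U")
    case False
    then have "x \<notin> ball y \<delta>" if "y \<in> E" for y using \<delta>(2) that by blast
    then have "ball x \<delta> \<subseteq> - E" by (auto simp: dist_commute)
    then have "f x \<le> emeasure \<mu> (- E)"
      unfolding f_def using E(1) by (intro emeasure_mono) (simp_all add: sets borel_comp borel_compact)
    then show ?thesis using False E(2) by simp
  qed simp
  have square: "(\<integral>\<^sup>+x. f x ^ 2 \<partial>lborel) \<le> ennreal (b * (D * \<delta> ^ DIM('a)))"
  proof -
    let ?S = "{z :: 'a \<times> 'a. dist (fst z) (snd z) < 2 * \<delta>}"
    define T where "T z x = (indicator (ball (fst z) \<delta>) x * indicator (ball (snd z) \<delta>) x :: ennreal)"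
      for z :: "'a \<times> 'a" and x
    have T[measurable]: "(\<lambda>(z, x). T z x) \<in> borel_measurable ((\<mu> \<Otimes>\<^sub>M \<mu>) \<Otimes>\<^sub>M lborel)"
      unfolding T_def indicator_def mem_ball by measurable
    have "{z \<in> space (\<mu> \<Otimes>\<^sub>M \<mu>). dist (fst z) (snd z) < 2 * \<delta>} \<in> sets (\<mu> \<Otimes>\<^sub>M \<mu>)" by measurable
    then have S[measurable]: "?S \<in> sets (\<mu> \<Otimes>\<^sub>M \<mu>)"
      by (simp add: space_pair_measure sp)
    have "f x ^ 2 = (\<integral>\<^sup>+z. T z x \<partial>(\<mu> \<Otimes>\<^sub>M \<mu>))" for x
    proof -
      have "f x ^ 2 = emeasure (\<mu> \<Otimes>\<^sub>M \<mu>) (ball x \<delta> \<times> ball x \<delta>)"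
        unfolding f_def power2_eq_square by (rule M.emeasure_pair_measure_Times[symmetric]) (auto simp: sets)
      also have "\<dots> = (\<integral>\<^sup>+z. indicator (ball x \<delta> \<times> ball x \<delta>) z \<partial>(\<mu> \<Otimes>\<^sub>M \<mu>))"
        by (rule nn_integral_indicator[symmetric]) (auto simp: sets intro!: pair_measureI)
      also have "\<dots> = (\<integral>\<^sup>+z. T z x \<partial>(\<mu> \<Otimes>\<^sub>M \<mu>))"
        by (intro nn_integral_cong) (auto simp: T_def indicator_def dist_commute)
      finally show ?thesis .
    qed
    then have "(\<integral>\<^sup>+x. f x ^ 2 \<partial>lborel) = (\<integral>\<^sup>+x. \<integral>\<^sup>+z. T z x \<partial>(\<mu> \<Otimes>\<^sub>M \<mu>) \<partial>lborel)" by simp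
    also have "\<dots> = (\<integral>\<^sup>+z. \<integral>\<^sup>+x. T z x \<partial>lborel \<partial>(\<mu> \<Otimes>\<^sub>M \<mu>))"
      by (rule QL.Fubini'[OF T])
    also have "\<dots> \<le> (\<integral>\<^sup>+z. ennreal b * indicator ?S z \<partial>(\<mu> \<Otimes>\<^sub>M \<mu>))"
    proof (rule nn_integral_mono)
      fix z :: "'a \<times> 'a"
      have "T z x \<le> indicator ?S z * indicator (ball (fst z) \<delta>) x" for x
        using dist_triangle_half_r[of x "fst z" "2 * \<delta>" "snd z"]
        by (auto simp: T_def indicator_def dist_commute)
      then have "(\<integral>\<^sup>+x. T z x \<partial>lborel) \<le> (\<integral>\<^sup>+x. indicator ?S z * indicator (ball (fst z) \<delta>) x \<partial>lborel)"
        by (intro nn_integral_mono)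
      also have "\<dots> = indicator ?S z * ennreal b"
        by (subst nn_integral_cmult) (simp_all add: ball borel_measurable_indicator)
      finally show "(\<integral>\<^sup>+x. T z x \<partial>lborel) \<le> ennreal b * indicator ?S z"
        by (simp only: mult.commute)
    qed
    also have "\<dots> = ennreal b * emeasure (\<mu> \<Otimes>\<^sub>M \<mu>) ?S"
      by (simp add: nn_integral_cmult)
    also have "\<dots> \<le> ennreal b * ennreal (D * \<delta> ^ DIM('a))"
      by (intro mult_left_mono diag \<delta>(1)) simp
    also have "\<dots> = ennreal (b * (D * \<delta> ^ DIM('a)))"
      using b by (simp add: ennreal_mult')
    finally show ?thesis .
  qed
  have "ennreal (b\<^sup>2) = (\<integral>\<^sup>+x. f x * indicator U x \<partial>lborel)\<^sup>2"
    using total b by (simp add: supp[symmetric] ennreal_power)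
  also have "\<dots> \<le> (\<integral>\<^sup>+x. f x ^ 2 \<partial>lborel) * (\<integral>\<^sup>+x. indicator U x ^ 2 \<partial>lborel)"
    by (intro Cauchy_Schwarz_nn_integral) measurable
  also have "(\<integral>\<^sup>+x. indicator U x ^ 2 \<partial>lborel) = (\<integral>\<^sup>+x. indicator U x \<partial>lborel)"
    by (intro nn_integral_cong) (simp add: indicator_def)
  also have "\<dots> = emeasure lborel U" by simp
  also have "(\<integral>\<^sup>+x. f x ^ 2 \<partial>lborel) * emeasure lborel U \<le> ennreal (b * (D * \<delta> ^ DIM('a))) * ennreal \<epsilon>"
    by (intro mult_mono square U\<epsilon>) auto
  also have "\<dots> = ennreal (b * (D * \<delta> ^ DIM('a)) * \<epsilon>)"
    using \<epsilon> by (simp add: ennreal_mult'')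
  finally have "b\<^sup>2 \<le> b * (D * \<delta> ^ DIM('a)) * \<epsilon>"
    using b \<epsilon> \<delta> \<open>0 \<le> D\<close> by (subst (asm) ennreal_le_iff) auto
  then have "\<omega> * \<delta> ^ DIM('a) \<le> (D * \<epsilon>) * \<delta> ^ DIM('a)"
    using b by (simp add: power2_eq_square b_def[symmetric] mult_ac)
  then have "\<omega> \<le> D * \<epsilon>"
    using \<delta>(1) by simp
  also have "D * \<epsilon> < \<omega>"
    using \<omega> \<open>0 \<le> D\<close> by (simp add: \<epsilon>_def field_simps) (smt (verit) mult_nonneg_nonneg)
  finally show False by simp
qed

text \<open>
  As $2\beta > d$, the function $\min(1, C^2 |\xi|^{-2\beta})$ is integrable, so $\hat\mu$ is square
  integrable and the mass near the diagonal is under control.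
\<close>

theorem emeasure_lebesgue_pos_if_Fourier_decay:
  fixes \<mu> :: "(real^'d) measure"
  assumes \<mu>: "prob_space \<mu>" "sets \<mu> = sets borel"
    and E: "compact E" "emeasure \<mu> (- E) = 0" and "0 < C"
    and decay: "\<And>\<xi>. \<xi> \<noteq> 0 \<Longrightarrow> cmod (fourier_transform \<mu> \<xi>) \<le> C * norm \<xi> powr - \<beta>"
    and \<beta>: "real CARD('d) / 2 < \<beta>"
  shows "0 < emeasure lebesgue E"
proof -
  interpret prob_space \<mu> by fact
  define n where "n = real CARD('d)"
  \<comment> \<open>With this \<open>c\<close> the decay reads \<open>(c / norm \<xi>) powr \<beta>\<close>, the form of the tail estimate.\<close>
  define c where "c = C powr (1 / \<beta>)"
  have "0 < \<beta>" using \<beta> by (smt (verit) divide_nonneg_nonneg of_nat_0_le_iff)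
  then have c: "0 < c" "c powr \<beta> = C" using \<open>0 < C\<close> by (simp_all add: c_def powr_powr)
  define B where "B = unit_ball_vol n * 2 powr n / (1 - 2 powr (n - 2 * \<beta>)) * c powr n"
  have B: "(\<integral>\<^sup>+\<xi>. ennreal ((cmod (fourier_transform \<mu> \<xi>))\<^sup>2) \<partial>lborel) \<le> ennreal B"
    unfolding B_def
  proof (rule nn_integral_power_tail[where a = norm])
    fix \<eta> :: real assume "0 < \<eta>"
    have "{\<xi> \<in> space lborel. norm \<xi> < \<eta>} = ball (0 :: real^'d) \<eta>" by auto
    then show "emeasure lborel {\<xi> \<in> space lborel. norm (\<xi> :: real^'d) < \<eta>}
        \<le> ennreal (unit_ball_vol n * \<eta> powr n)"
      using \<open>0 < \<eta>\<close> by (simp add: emeasure_ball n_def powr_realpow)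
  next
    fix \<xi> :: "real^'d"
    have "cmod (fourier_transform \<mu> \<xi>) \<le> 1"
      unfolding fourier_transform_eq by (rule norm_integral_le_1) simp
    then show "(cmod (fourier_transform \<mu> \<xi>))\<^sup>2 \<le> 1" by (simp add: power_le_one)
    assume "0 < norm \<xi>"
    then have "cmod (fourier_transform \<mu> \<xi>) \<le> (c / norm \<xi>) powr \<beta>"
      using decay[of \<xi>] by (simp add: powr_divide powr_minus_divide c)
    then have "(cmod (fourier_transform \<mu> \<xi>))\<^sup>2 \<le> ((c / norm \<xi>) powr \<beta>)\<^sup>2"
      by (intro power_mono) auto
    also have "\<dots> = (c / norm \<xi>) powr (2 * \<beta>)"
      by (simp add: power2_eq_square flip: powr_add)
    finally show "(cmod (fourier_transform \<mu> \<xi>))\<^sup>2 \<le> (c / norm \<xi>) powr (2 * \<beta>)" .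
  qed (use c \<beta> \<open>0 < \<beta>\<close> in \<open>auto simp: n_def\<close>)
  have "0 \<le> B"
    using \<beta> by (simp add: B_def n_def powr_less_one less_imp_le)
  show ?thesis
    by (rule emeasure_lebesgue_pos_if_near_diagonal_mass[OF \<mu> E, of "exp (4 * pi) * B"])
       (use near_diagonal_mass[OF \<mu> B \<open>0 \<le> B\<close>] \<open>0 \<le> B\<close> in \<open>simp_all add: mult.assoc\<close>)
qed

section \<open>Fourier dimension and Lebesgue measure of the set\<close>

theorem theorem2p1:
  fixes k :: nat and \<beta> :: real
    and x :: "(real^'d) set \<Rightarrow> nat \<Rightarrow> real^'d"
    and \<Gamma> :: "(real^'d) set set" and E :: "(real^'d) set"
  assumes "2 \<le> CARD('d)" and "1 \<le> k" and "k < CARD('d)"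
    and "0 \<le> \<beta>"
    and "orthonormal_basis_choice k x"
    and "\<Gamma> \<subseteq> grassmannian k"
    and "beta_scaling k x \<beta> \<Gamma>"
    and "compact E"
    and "dkGamma_set k x \<Gamma> E"
  shows "fourier_dim E \<ge> min (2 * \<beta>) (real CARD('d)) \<and>
         (\<beta> > real CARD('d) / 2 \<longrightarrow> emeasure lebesgue E > 0)"
proof -
  obtain \<mu> C where \<mu>: "prob_space \<mu>" "sets \<mu> = sets borel" "emeasure \<mu> (- E) = 0" and C: "0 < C"
    and decay: "\<And>\<xi>. \<xi> \<noteq> 0 \<Longrightarrow> cmod (fourier_transform \<mu> \<xi>) \<le> C * norm \<xi> powr - \<beta>"
    using exists_measure_with_Fourier_decay[OF assms(2,4,5,7,8,9)] by metis
  interpret prob_space \<mu> by fact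
  define s where "s = min (2 * \<beta>) (real CARD('d))"
  have s: "0 \<le> s" "s \<le> real CARD('d)" "s / 2 \<le> \<beta>"
    using \<open>0 \<le> \<beta>\<close> by (auto simp: s_def)
  have "cmod (fourier_transform \<mu> \<xi>) \<le> (C + 1) * norm \<xi> powr (- s / 2)" if \<xi>: "\<xi> \<noteq> 0" for \<xi>
  \<comment> \<open>Near the origin the exponent \<open>-s / 2\<close> may be larger than \<open>-\<beta>\<close>, but there the trivial bound 1 suffices.\<close>
  proof (cases "norm \<xi> \<le> 1")
    case True
    have "cmod (fourier_transform \<mu> \<xi>) \<le> 1 * 1"
      unfolding fourier_transform_eq by (simp add: norm_integral_le_1)
    also have "\<dots> \<le> (C + 1) * norm \<xi> powr (- s / 2)"
      using True \<xi> s(1) C ge_one_powr_ge_zero[of "1 / norm \<xi>" "s / 2"]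
      by (intro mult_mono) (auto simp: powr_divide powr_minus_divide)
    finally show ?thesis .
  next
    case False
    have "cmod (fourier_transform \<mu> \<xi>) \<le> C * norm \<xi> powr - \<beta>" by (rule decay[OF \<xi>])
    also have "\<dots> \<le> (C + 1) * norm \<xi> powr (- s / 2)"
      using False s(3) C by (intro mult_mono powr_mono) auto
    finally show ?thesis .
  qed
  then have "s \<in> {s \<in> {0..real CARD('d)}.
     \<exists>\<mu>. prob_space \<mu> \<and> sets \<mu> = sets borel \<and> emeasure \<mu> (- E) = 0 \<and>
         (\<exists>C>0. \<forall>\<xi>. \<xi> \<noteq> 0 \<longrightarrow> cmod (fourier_transform \<mu> \<xi>) \<le> C * norm \<xi> powr (- s / 2))}"
    using \<mu> C s by (intro CollectI conjI exI[of _ \<mu>] exI[of _ "C + 1"]) auto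
  then have "s \<le> fourier_dim E"
    unfolding fourier_dim_def by (rule cSup_upper) (auto intro!: bdd_aboveI[of _ "real CARD('d)"])
  moreover have "0 < emeasure lebesgue E" if "real CARD('d) / 2 < \<beta>"
    by (rule emeasure_lebesgue_pos_if_Fourier_decay[OF \<mu>(1,2) \<open>compact E\<close> \<mu>(3) C decay that])
  ultimately show ?thesis by (simp add: s_def)
qed

end
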